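(* Let $d\ge1$, let $M=S^d$ be the standard sphere, and let $P=\Delta^{\alpha/2}$ with $\alpha\in(0,\infty)\setminus\{1\}$ or $P=\sqrt{m^2+\Delta}$ with $m\ge0$. Let $p,q\ge2$, $\sigma\in\mathbb{R}$, $\beta\in(0,\infty]$, and let $I\subset\mathbb{R}$ be a bounded interval of positive length. Suppose there is a constant $C$ such that for all $N\ge10$ $$\Big\|\sum_j\nu_j|e^{itP}f_j|^2\Big\|_{L^{p/2}_tL^{q/2}_x(I\times M)}\le C\,|I|^{\frac2p}N^{\sigma}\|\nu\|_{\ell^\beta}$$ holds for all orthonormal systems $(f_j)_j$ in $L^2(M)$ with $\operatorname{supp}\hat f_j\subset\{k:\lambda_k\le N\}$ and all sequences $\nu=(\nu_j)_j\in\ell^\beta$. Then $$\frac1\beta\ge d-\frac{2d}q-\sigma.$$ If moreover $\frac1p=\frac d2\left(\frac12-\frac1q\right)$, this condition is equivalent to $\frac1\beta\ge\frac4p-\sigma$.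
   Context: $\Delta=-\Delta_g$ is the nonnegative Laplace–Beltrami operator on $M$. $(e_k)_k$ is a fixed orthonormal basis of $L^2(M)$ of eigenfunctions, $\sqrt\Delta\, e_k=\lambda_k e_k$, with $0=\lambda_0<\lambda_1\le\lambda_2\le\dots$ counted with multiplicity. For $f\in L^2(M)$, $\hat f(k)=\langle f,e_k\rangle$; $e^{itP}$ is defined by the spectral theorem, i.e. $e^{itP}f=\sum_k e^{it\lambda_k^\alpha}\hat f(k)e_k$ or $\sum_k e^{it\sqrt{m^2+\lambda_k^2}}\hat f(k)e_k$ respectively. Mixed norms: $\|F\|_{L^a_tL^b_x(I\times M)}=\big\|\,\|F(t,\cdot)\|_{L^b(M)}\big\|_{L^a(I)}$. *)

theory Defs
  imports "HOL-Analysis.Analysis" "HOL-Probability.Essential_Supremum"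
begin

section \<open>Lebesgue norms with exponent in (0, \<infinity>]\<close>

text \<open>Norms take values in \<open>ennreal\<close>, so that the norm of a function outside the space is \<open>\<infinity>\<close>
  and not a junk value. Exponents are \<open>ennreal\<close> as well, with \<open>1 / \<infinity> = 0\<close>.\<close>

definition ennpowr :: "ennreal \<Rightarrow> real \<Rightarrow> ennreal" where
  "ennpowr y r = (if y = \<infinity> then \<infinity> else ennreal (enn2real y powr r))"

definition recip :: "ennreal \<Rightarrow> real" where
  "recip a = enn2real (1 / a)"

definition Lnorm :: "'b measure \<Rightarrow> ennreal \<Rightarrow> ('b \<Rightarrow> ennreal) \<Rightarrow> ennreal" where
  "Lnorm M a g =
     (if a = \<infinity> then esssup M g
      else ennpowr (\<integral>\<^sup>+ x. ennpowr (g x) (enn2real a) \<partial>M) (recip a))"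

definition mixed_norm ::
  "real set \<Rightarrow> 'b measure \<Rightarrow> ennreal \<Rightarrow> ennreal \<Rightarrow> (real \<Rightarrow> 'b \<Rightarrow> complex) \<Rightarrow> ennreal" where
  "mixed_norm I M a b F =
     Lnorm (restrict_space lborel I) a (\<lambda>t. Lnorm M b (\<lambda>x. ennreal (cmod (F t x))))"

definition seq_norm :: "nat set \<Rightarrow> ennreal \<Rightarrow> (nat \<Rightarrow> complex) \<Rightarrow> ennreal" where
  "seq_norm J b \<nu> = Lnorm (count_space J) b (\<lambda>j. ennreal (cmod (\<nu> j)))"


section \<open>The Hilbert space of square-integrable functions\<close>

definition in_L2 :: "'b measure \<Rightarrow> ('b \<Rightarrow> complex) \<Rightarrow> bool" where
  "in_L2 M f \<longleftrightarrow> f \<in> borel_measurable M \<and> integrable M (\<lambda>x. (cmod (f x))\<^sup>2)"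

definition L2_inner :: "'b measure \<Rightarrow> ('b \<Rightarrow> complex) \<Rightarrow> ('b \<Rightarrow> complex) \<Rightarrow> complex" where
  "L2_inner M f g = (LINT x|M. f x * cnj (g x))"

definition orthonormal_system :: "'b measure \<Rightarrow> nat set \<Rightarrow> (nat \<Rightarrow> 'b \<Rightarrow> complex) \<Rightarrow> bool" where
  "orthonormal_system M J f \<longleftrightarrow>
     (\<forall>j\<in>J. in_L2 M (f j)) \<and>
     (\<forall>i\<in>J. \<forall>j\<in>J. L2_inner M (f i) (f j) = (if i = j then 1 else 0))"

definition L2_series :: "'b measure \<Rightarrow> (nat \<Rightarrow> 'b \<Rightarrow> complex) \<Rightarrow> (nat \<Rightarrow> complex) \<Rightarrow> ('b \<Rightarrow> complex) \<Rightarrow> bool" where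
  "L2_series M e c g \<longleftrightarrow>
     in_L2 M g \<and> (\<lambda>n. LINT x|M. (cmod (g x - (\<Sum>k<n. c k * e k x)))\<^sup>2) \<longlonglongrightarrow> 0"

definition orthonormal_basis :: "'b measure \<Rightarrow> (nat \<Rightarrow> 'b \<Rightarrow> complex) \<Rightarrow> bool" where
  "orthonormal_basis M e \<longleftrightarrow>
     orthonormal_system M UNIV e \<and>
     (\<forall>f. in_L2 M f \<longrightarrow> L2_series M e (\<lambda>k. L2_inner M f (e k)) f)"


section \<open>The unit sphere as a Riemannian manifold\<close>

text \<open>The Riemannian volume of the unit sphere of an \<open>n\<close>-dimensional Euclidean space, by
  integration in polar coordinates: a Borel set \<open>A\<close> of the sphere has volume \<open>n\<close> times the
  Lebesgue measure of the cone \<open>{r x | 0 < r \<le> 1, x \<in> A}\<close>.\<close>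

definition sphere_measure :: "'a::euclidean_space measure" where
  "sphere_measure =
     scale_measure (of_nat DIM('a))
       (distr (restrict_space lborel (cball 0 1 - {0})) (restrict_space borel (sphere 0 1))
         (\<lambda>y. y /\<^sub>R norm y))"

text \<open>The tangent space at \<open>x\<close> is \<open>{v. v \<bullet> x = 0}\<close> with the inner product of the ambient space.
  A derivative within the sphere determines a linear map on the tangent space only;
  its value in the normal direction is arbitrary. In \<open>sphere_grad\<close> and \<open>sphere_div\<close> this
  freedom is removed by tangency of the gradient and by \<open>D x = 0\<close>.\<close>

definition has_sphere_grad :: "('a::euclidean_space \<Rightarrow> real) \<Rightarrow> 'a \<Rightarrow> 'a \<Rightarrow> bool" where
  "has_sphere_grad f v x \<longleftrightarrow>
     v \<bullet> x = 0 \<and> (f has_derivative (\<lambda>h. v \<bullet> h)) (at x within sphere 0 1)"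

definition sphere_grad :: "('a::euclidean_space \<Rightarrow> real) \<Rightarrow> 'a \<Rightarrow> 'a" where
  "sphere_grad f x = (THE v. has_sphere_grad f v x)"

text \<open>The Levi-Civita derivative of a tangent field \<open>X\<close> is the tangential part of \<open>D\<close>, and the
  divergence is its trace over the tangent space. Since \<open>D x = 0\<close>, this is the trace of \<open>D\<close>.\<close>

definition sphere_div :: "('a::euclidean_space \<Rightarrow> 'a) \<Rightarrow> 'a \<Rightarrow> real" where
  "sphere_div X x =
     (THE s. \<exists>D. (X has_derivative D) (at x within sphere 0 1) \<and> D x = 0 \<and>
        s = (\<Sum>b\<in>Basis. D b \<bullet> b))"

definition C2_sphere :: "('a::euclidean_space \<Rightarrow> real) \<Rightarrow> bool" where
  "C2_sphere f \<longleftrightarrow>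
     (\<forall>x\<in>sphere 0 1. \<exists>v. has_sphere_grad f v x) \<and>
     (\<exists>D :: 'a \<Rightarrow> 'a \<Rightarrow>\<^sub>L 'a. continuous_on (sphere 0 1) D \<and>
        (\<forall>x\<in>sphere 0 1. (sphere_grad f has_derivative blinfun_apply (D x)) (at x within sphere 0 1)))"

text \<open>The nonnegative operator \<open>- div grad\<close>.\<close>

definition sphere_laplacian :: "('a::euclidean_space \<Rightarrow> real) \<Rightarrow> 'a \<Rightarrow> real" where
  "sphere_laplacian f x = - sphere_div (sphere_grad f) x"

text \<open>An eigenfunction of the self-adjoint Laplacian on \<open>L\<^sup>2\<close> has, by elliptic regularity, a
  smooth representative; here eigenfunctions are these representatives. For \<open>\<mu> \<ge> 0\<close>, being an
  eigenfunction of the square root of the Laplacian with eigenvalue \<open>\<mu>\<close> means being an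
  eigenfunction of the Laplacian with eigenvalue \<open>\<mu>\<^sup>2\<close>.\<close>

definition sqrt_laplacian_eigenfunction :: "('a::euclidean_space \<Rightarrow> complex) \<Rightarrow> real \<Rightarrow> bool" where
  "sqrt_laplacian_eigenfunction u \<mu> \<longleftrightarrow>
     \<mu> \<ge> 0 \<and> C2_sphere (\<lambda>x. Re (u x)) \<and> C2_sphere (\<lambda>x. Im (u x)) \<and>
     (\<forall>x\<in>sphere 0 1.
        Complex (sphere_laplacian (\<lambda>y. Re (u y)) x) (sphere_laplacian (\<lambda>y. Im (u y)) x)
          = complex_of_real (\<mu>\<^sup>2) * u x)"

definition laplace_eigenbasis :: "(nat \<Rightarrow> 'a::euclidean_space \<Rightarrow> complex) \<Rightarrow> (nat \<Rightarrow> real) \<Rightarrow> bool" where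
  "laplace_eigenbasis e lam \<longleftrightarrow>
     orthonormal_basis sphere_measure e \<and>
     (\<forall>k. sqrt_laplacian_eigenfunction (e k) (lam k)) \<and>
     lam 0 = 0 \<and> 0 < lam 1 \<and> mono lam"

abbreviation fourier_coeff ::
  "(nat \<Rightarrow> 'a::euclidean_space \<Rightarrow> complex) \<Rightarrow> ('a \<Rightarrow> complex) \<Rightarrow> nat \<Rightarrow> complex" where
  "fourier_coeff e f k \<equiv> L2_inner sphere_measure f (e k)"

text \<open>The operator \<open>e\<^bsup>i t \<phi>(\<surd>\<Delta>)\<^esup>\<close>. The sum of the series in \<open>L\<^sup>2\<close> is determined up to null sets
  only, and a representative is chosen for each time separately. This is harmless in
  \<open>mixed_norm\<close>, which takes the norm in space at each fixed time first.\<close>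

definition propagator ::
  "(nat \<Rightarrow> 'a::euclidean_space \<Rightarrow> complex) \<Rightarrow> (nat \<Rightarrow> real) \<Rightarrow> (real \<Rightarrow> real) \<Rightarrow>
     real \<Rightarrow> ('a \<Rightarrow> complex) \<Rightarrow> 'a \<Rightarrow> complex" where
  "propagator e lam \<phi> t f =
     (SOME g. L2_series sphere_measure e (\<lambda>k. cis (t * \<phi> (lam k)) * fourier_coeff e f k) g)"

end

theory Submission
  imports Defs
begin

text \<open>For \<open>M \<le> m < 2 M\<close> let \<open>f\<^sub>m\<close> be the \<open>L\<^sup>2\<close>-normalised zonal eigenfunction of degree \<open>2 m\<close> about a
  common pole. The propagator multiplies each \<open>f\<^sub>m\<close> by a phase, so \<open>\<Sum> |e\<^bsup>i t P\<^esup> f\<^sub>m|\<^sup>2 = \<Sum> |f\<^sub>m|\<^sup>2\<close>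
  for all \<open>t\<close> and whatever \<open>P\<close> is. At distance at most \<open>c / M\<close> from the pole each \<open>|f\<^sub>m|\<^sup>2\<close> has size
  \<open>M\<^bsup>d - 1\<^esup>\<close>, so the sum has size \<open>M\<^bsup>d\<^esup>\<close> on a cap of measure about \<open>M\<^bsup>-d\<^esup>\<close>, and its
  \<open>L\<^bsup>q/2\<^esup>\<close> norm is at least of order \<open>M\<^bsup>d - 2 d / q\<^esup>\<close>. With \<open>\<nu> = 1\<close> the right-hand side is of order
  \<open>M\<^bsup>\<sigma> + 1 / \<beta>\<^esup>\<close>; let \<open>M\<close> tend to infinity.

  The size of \<open>f\<^sub>m\<close> is read off the ordinary differential equation of the zonal functions by energy
  estimates. That \<open>f\<^sub>m\<close> has only one frequency in an arbitrary eigenbasis is Green's formula on the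
  sphere.\<close>

section \<open>Zonal polynomials\<close>

text \<open>The lower bound near the pole is cheap, because the zonal functions are normalised to be
  1 there. The substance is an upper bound of order \<open>\<mu>\<close> to the power
  \<open>1 - d\<close> for the integral of their squares, \<open>\<mu>\<close> being the frequency.
  Away from the pole the profile oscillates with an amplitude decaying like \<open>s\<close> to the
  power \<open>- (d - 1) / 2\<close>, as in a WKB approximation. Monotonicity of the energy
  \<open>E\<close> alone only gives a bound by 1, and the weighted energy
  \<open>s ^ \<delta> * E\<close> oscillates; the correction \<open>B\<close> takes out the
  oscillation. Even degrees are symmetric about the equator, so one profile on
  \<open>0 \<le> s \<le> 1\<close> serves both hemispheres. Polar coordinates are avoided in the
  integration: at distance about \<open>2 ^ -k\<close> from the axis the square is at most of order
  \<open>(2 ^ k / \<mu>) ^ (d - 1)\<close> on a set of measure at most of order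
  \<open>2 ^ (- k * d)\<close>, and the products form a geometric series. Comparing cones with boxes
  is then enough for all measures of caps. The constants are generous, since only the exponent of
  \<open>M\<close> survives in the limit. Green's formula is reduced to the rotation invariance of
  the surface measure, and this to that of Lebesgue measure.\<close>

text \<open>The zonal function of degree \<open>n = 2 m\<close> is \<open>G (x \<bullet> b)\<close> for the polynomial solution \<open>G\<close> of
  \<open>(1 - t\<^sup>2) G'' - d t G' + n (n + d - 1) G = 0\<close>. For even \<open>n\<close> it is a polynomial in
  \<open>w = 1 - t\<^sup>2\<close>; these are its coefficients, from the recursion that the equation gives in \<open>w\<close>,
  normalised to be 1 at the poles.\<close>

fun zonal_coeff :: "nat \<Rightarrow> nat \<Rightarrow> nat \<Rightarrow> real" where
  "zonal_coeff d m 0 = 1"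
| "zonal_coeff d m (Suc k) =
     (real (2 * k) * (real (2 * k) + real d - 1) - real (2 * m) * (real (2 * m) + real d - 1))
       / (real (Suc k) * (4 * real k + 2 * real d)) * zonal_coeff d m k"

text \<open>The numerator of the recursion vanishes at \<open>k = m\<close>. In the variable
  \<open>w\<close> only even degrees make the series terminate.\<close>

lemma zonal_coeff_eq_0: "k > m \<Longrightarrow> zonal_coeff d m k = 0"
proof (induction k)
  case (Suc k)
  then show ?case by (cases "k = m") auto
qed simp

definition zonal_poly :: "nat \<Rightarrow> nat \<Rightarrow> real poly" where
  "zonal_poly d m = (\<Sum>k\<le>m. monom (zonal_coeff d m k) k)"

lemma coeff_zonal_poly: "coeff (zonal_poly d m) k = zonal_coeff d m k"
  by (simp add: zonal_poly_def coeff_sum zonal_coeff_eq_0 not_le)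

text \<open>Spherical harmonics of degree \<open>n\<close> on the \<open>d\<close>-sphere have
  eigenvalue \<open>n * (n + d - 1)\<close>; this is its square root at
  \<open>n = 2 * m\<close>.\<close>

definition zonal_freq :: "nat \<Rightarrow> nat \<Rightarrow> real" where
  "zonal_freq d m = sqrt (real (2 * m) * (real (2 * m) + real d - 1))"

lemma zonal_freq_sq:
  "d \<ge> 1 \<Longrightarrow> (zonal_freq d m)\<^sup>2 = real (2 * m) * (real (2 * m) + real d - 1)"
  by (simp add: zonal_freq_def)

text \<open>The coefficient of \<open>w ^ k\<close> on the left is \<open>(k + 1) * (4 * k + 2 * d)
  * c (k + 1) - (2 * k * (2 * k + d - 1) - \<mu>) * c k\<close> with the eigenvalue
  \<open>\<mu>\<close>; this vanishes by the recursion.\<close>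

lemma zonal_poly_ode:
  assumes "d \<ge> 1"
  shows "[:0, 4, -4:] * pderiv (pderiv (zonal_poly d m))
     + [:2 * real d, - (2 * real d + 2):] * pderiv (zonal_poly d m)
     + smult ((zonal_freq d m)\<^sup>2) (zonal_poly d m) = 0"
proof (rule poly_eqI)
  fix k
  define \<mu> where "\<mu> = real (2 * m) * (real (2 * m) + real d - 1)"
  define c where "c = zonal_coeff d m"
  have rec: "c (Suc k) * (real (Suc k) * (4 * real k + 2 * real d))
       = (real (2 * k) * (real (2 * k) + real d - 1) - \<mu>) * c k" for k
    using assms by (simp add: c_def \<mu>_def del: of_nat_Suc)
  have freq: "(zonal_freq d m)\<^sup>2 = \<mu>"
    using assms by (simp add: \<mu>_def zonal_freq_sq)
  have coeff: "coeff (zonal_poly d m) k = c k" for k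
    by (simp add: c_def coeff_zonal_poly)
  show "coeff ([:0, 4, -4:] * pderiv (pderiv (zonal_poly d m))
     + [:2 * real d, - (2 * real d + 2):] * pderiv (zonal_poly d m)
     + smult ((zonal_freq d m)\<^sup>2) (zonal_poly d m)) k = coeff 0 k"
  \<comment> \<open>The quadratic factor shifts indices by up to two, so the degrees 0 and 1 are
    checked separately.\<close>
  proof (cases k)
    case 0
    then show ?thesis using rec[of 0] assms
      by (simp add: freq coeff_pderiv coeff algebra_simps)
  next
    case (Suc j)
    show ?thesis
    proof (cases j)
      case 0
      then show ?thesis using rec[of 1] Suc assms
        by (simp add: freq coeff_pderiv coeff algebra_simps)
    next
      case (Suc i)
      then show ?thesis using rec[of "Suc (Suc i)"] \<open>k = Suc j\<close> assms
        by (simp add: freq coeff_pderiv coeff algebra_simps)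
    qed
  qed
qed

lemma poly_zonal_ode:
  assumes "d \<ge> 1"
  shows "4 * w * (1 - w) * poly (pderiv (pderiv (zonal_poly d m))) w
     + (2 * real d - (2 * real d + 2) * w) * poly (pderiv (zonal_poly d m)) w
     + (zonal_freq d m)\<^sup>2 * poly (zonal_poly d m) w = 0"
  using arg_cong[OF zonal_poly_ode[OF assms, of m], of "\<lambda>p. poly p w"]
  by (simp add: algebra_simps)

lemma poly_zonal_0: "poly (zonal_poly d m) 0 = 1"
  by (simp add: poly_0_coeff_0 coeff_zonal_poly)

section \<open>Energy estimates for the zonal profile\<close>

text \<open>The equation in the variable \<open>s = sin \<theta>\<close>, where \<open>\<theta>\<close> is the distance to the pole and
  \<open>\<delta> = d - 1\<close>; \<open>E\<close> is the energy \<open>(dK/d\<theta>)\<^sup>2 + \<mu>\<^sup>2 K\<^sup>2\<close>.\<close>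

locale zonal_profile =
  fixes \<delta> :: nat and \<mu> :: real and K K1 K2 :: "real \<Rightarrow> real"
  assumes freq_pos: "\<mu> > 0"
    and DERIV_K: "\<And>s. (K has_real_derivative K1 s) (at s)"
    and DERIV_K1: "\<And>s. (K1 has_real_derivative K2 s) (at s)"
    and ode: "\<And>s::real. s * (1 - s\<^sup>2) * K2 s + (real \<delta> * (1 - s\<^sup>2) - s\<^sup>2) * K1 s + \<mu>\<^sup>2 * s * K s = 0"
    and K_0: "K 0 = 1" and K1_0: "K1 0 = 0"
begin

definition E :: "real \<Rightarrow> real" where
  "E s = (1 - s\<^sup>2) * (K1 s)\<^sup>2 + \<mu>\<^sup>2 * (K s)\<^sup>2"

lemma ode_pos:
  assumes "(s::real) > 0"
  shows "(1 - s\<^sup>2) * K2 s = s * K1 s - real \<delta> * (1 - s\<^sup>2) / s * K1 s - \<mu>\<^sup>2 * K s"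
  using ode[of s] assms by (simp add: field_simps power2_eq_square)

text \<open>In the angle \<theta> the equation is that of an oscillator with friction coefficient
  \<open>\<delta> * cot \<theta>\<close>, so energy is only lost on the way from the pole to the
  equator.\<close>

lemma DERIV_E:
  assumes "(s::real) > 0"
  shows "(E has_real_derivative - 2 * real \<delta> * (1 - s\<^sup>2) / s * (K1 s)\<^sup>2) (at s)"
proof -
  have "(E has_real_derivative
      (- 2 * s) * (K1 s)\<^sup>2 + 2 * K1 s * ((1 - s\<^sup>2) * K2 s) + \<mu>\<^sup>2 * (2 * K s * K1 s)) (at s)"
    unfolding E_def
    by (auto intro!: derivative_eq_intros DERIV_K DERIV_K1 simp: algebra_simps)
  also have "(- 2 * s) * (K1 s)\<^sup>2 + 2 * K1 s * ((1 - s\<^sup>2) * K2 s) + \<mu>\<^sup>2 * (2 * K s * K1 s)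
      = - 2 * real \<delta> * (1 - s\<^sup>2) / s * (K1 s)\<^sup>2"
    unfolding ode_pos[OF assms] using assms by (simp add: field_simps power2_eq_square)
  finally show ?thesis .
qed

lemma cont_K: "continuous_on A K" and cont_K1: "continuous_on A K1"
  using DERIV_K DERIV_K1 by (meson DERIV_isCont continuous_at_imp_continuous_on)+

lemma cont_E: "continuous_on A E"
  unfolding E_def by (intro continuous_intros cont_K cont_K1)

lemma E_antimono:
  assumes "0 \<le> (a::real)" "a \<le> b" "b \<le> 1"
  shows "E b \<le> E a"
proof (rule DERIV_nonpos_imp_decreasing_open[OF assms(2)])
  fix x assume x: "a < x" "x < b"
  then have "x\<^sup>2 \<le> 1" using assms by (simp add: power_le_one)
  with x show "\<exists>y. (E has_real_derivative y) (at x) \<and> y \<le> 0"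
    using DERIV_E[of x] assms by (intro exI[of _ "- 2 * real \<delta> * (1 - x\<^sup>2) / x * (K1 x)\<^sup>2"])
      (auto simp: divide_nonneg_pos)
qed (rule cont_E)

lemma E_le: "0 \<le> (s::real) \<Longrightarrow> s \<le> 1 \<Longrightarrow> E s \<le> \<mu>\<^sup>2"
  using E_antimono[of 0 s] by (simp add: E_def K_0 K1_0)

lemma E_ge:
  assumes "0 \<le> (s::real)" "s \<le> 1"
  shows "\<mu>\<^sup>2 * (K s)\<^sup>2 \<le> E s" "(1 - s\<^sup>2) * (K1 s)\<^sup>2 \<le> E s" "0 \<le> E s"
  using assms by (auto simp: E_def power_le_one intro!: add_nonneg_nonneg mult_nonneg_nonneg)

lemma K_sq_le_1:
  assumes "0 \<le> (s::real)" "s \<le> 1"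
  shows "(K s)\<^sup>2 \<le> 1"
proof -
  have "\<mu>\<^sup>2 * (K s)\<^sup>2 \<le> \<mu>\<^sup>2 * 1"
    using E_ge[OF assms] E_le[OF assms] by linarith
  then show ?thesis using freq_pos by (subst (asm) mult_le_cancel_left_pos) auto
qed

text \<open>The energy controls dK/d\<theta>, which is \<open>K1\<close> times the cosine of
  \<theta>; the condition on \<open>s\<close> keeps the squared cosine above 1/2.\<close>

lemma K1_bound:
  assumes "0 \<le> (s::real)" "2 * s\<^sup>2 \<le> 1"
  shows "\<bar>K1 s\<bar> \<le> 2 * \<mu>"
proof -
  have s: "s \<le> 1" using assms by (simp add: power2_le_imp_le[of s 1])
  have "1/2 * (K1 s)\<^sup>2 \<le> (1 - s\<^sup>2) * (K1 s)\<^sup>2"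
    using assms by (intro mult_right_mono) auto
  also have "\<dots> \<le> \<mu>\<^sup>2" using E_ge(2)[OF assms(1) s] E_le[OF assms(1) s] by linarith
  finally have "(K1 s)\<^sup>2 \<le> 4 * \<mu>\<^sup>2" using zero_le_power2[of \<mu>] by linarith
  then have "(K1 s)\<^sup>2 \<le> (2 * \<mu>)\<^sup>2" by (simp add: power_mult_distrib)
  then show ?thesis using freq_pos abs_le_square_iff[of "K1 s" "2 * \<mu>"] by simp
qed

text \<open>Mean value theorem: starting from 1 with slope at most \<open>2 * \<mu>\<close>, the
  profile loses at most 1/2 over a length \<open>1 / (4 * \<mu>)\<close>.\<close>

lemma K_near_0:
  assumes "0 \<le> (s::real)" "2 * s\<^sup>2 \<le> 1" "4 * \<mu> * s \<le> 1"
  shows "K s \<ge> 1/2"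
proof -
  have "\<bar>K s - K 0\<bar> \<le> 2 * \<mu> * \<bar>s - 0\<bar>"
  proof (rule field_differentiable_bound[where S = "{0..s}", unfolded real_norm_def])
    fix x assume x: "x \<in> {0..s}"
    then show "(K has_real_derivative K1 x) (at x within {0..s})"
      using DERIV_K DERIV_subset by blast
    have "x\<^sup>2 \<le> s\<^sup>2" using x by (intro power_mono) auto
    then show "\<bar>K1 x\<bar> \<le> 2 * \<mu>" using K1_bound[of x] x assms by auto
  qed (use assms in auto)
  with assms show ?thesis by (simp add: K_0)
qed

text \<open>\<open>s\<^sup>\<delta> E\<close> is not monotone, but \<open>s\<^sup>\<delta> E + B\<close> has a derivative of
  size \<open>s\<^sup>\<delta> E / (\<mu> s\<^sup>2)\<close>, which is integrable on \<open>s \<ge> 1 / \<mu>\<close> uniformly in \<open>\<mu>\<close>.\<close>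

definition B :: "real \<Rightarrow> real" where
  "B s = real \<delta> * s ^ \<delta> / s * (1 - s\<^sup>2) * (K s * K1 s)"
definition T :: "real \<Rightarrow> real" where
  "T s = s ^ \<delta> * E s + B s"

text \<open>Dividing by \<open>s\<close> avoids the truncated exponent \<open>n - 1\<close>, so that
  \<open>n = 0\<close>, which occurs on the circle, needs no separate treatment.\<close>

lemma DERIV_power_div: "(s::real) > 0 \<Longrightarrow> ((\<lambda>s::real. s ^ n) has_real_derivative real n * s ^ n / s) (at s)"
  using DERIV_pow[of n s] by (cases n) auto

text \<open>Differentiating \<open>s ^ \<delta> * E\<close> produces the difference
  \<open>\<mu>\<^sup>2 * (K s)\<^sup>2 - (1 - s\<^sup>2) * (K1 s)\<^sup>2\<close> of potential and
  kinetic energy, which averages out over an oscillation. By the equation this is, up to lower order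
  terms, minus the derivative of \<open>(1 - s\<^sup>2) * (K s * K1 s)\<close>, and \<open>B\<close>
  is weighted so that the two cancel.\<close>

lemma DERIV_T:
  assumes "(s::real) > 0"
  shows "(T has_real_derivative - real \<delta> * s ^ \<delta> / s\<^sup>2 * (K s * K1 s)) (at s)"
proof -
  define P where "P = s ^ \<delta>"
  have E: "((\<lambda>s. s ^ \<delta> * E s) has_real_derivative
      real \<delta> * P / s * E s + P * (- 2 * real \<delta> * (1 - s\<^sup>2) / s * (K1 s)\<^sup>2)) (at s)"
    using DERIV_mult[OF DERIV_power_div[OF assms, of \<delta>] DERIV_E[OF assms]]
    by (simp add: P_def algebra_simps)
  have D1: "((\<lambda>s. s ^ \<delta> / s) has_real_derivative (real \<delta> * P / s * s - P) / s\<^sup>2) (at s)"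
    using DERIV_divide[OF DERIV_power_div[OF assms, of \<delta>] DERIV_ident] assms
    by (simp add: P_def power2_eq_square)
  have D2: "((\<lambda>s. (1 - s\<^sup>2) * (K s * K1 s)) has_real_derivative
      (- 2 * s) * (K s * K1 s) + (1 - s\<^sup>2) * (K1 s)\<^sup>2 + K s * ((1 - s\<^sup>2) * K2 s)) (at s)"
    by (auto intro!: derivative_eq_intros DERIV_K DERIV_K1 simp: algebra_simps power2_eq_square)
  have B: "(B has_real_derivative real \<delta> * ((real \<delta> * P / s * s - P) / s\<^sup>2 * ((1 - s\<^sup>2) * (K s * K1 s))
      + ((- 2 * s) * (K s * K1 s) + (1 - s\<^sup>2) * (K1 s)\<^sup>2 + K s * ((1 - s\<^sup>2) * K2 s)) * (P / s))) (at s)"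
    using DERIV_cmult[OF DERIV_mult[OF D1 D2], of "real \<delta>"]
    by (simp add: B_def[abs_def] P_def mult.assoc)
  have "(T has_real_derivative
      real \<delta> * P / s * E s + P * (- 2 * real \<delta> * (1 - s\<^sup>2) / s * (K1 s)\<^sup>2)
      + real \<delta> * ((real \<delta> * P / s * s - P) / s\<^sup>2 * ((1 - s\<^sup>2) * (K s * K1 s))
      + ((- 2 * s) * (K s * K1 s) + (1 - s\<^sup>2) * (K1 s)\<^sup>2 + K s * ((1 - s\<^sup>2) * K2 s)) * (P / s))) (at s)"
    using DERIV_add[OF E B] by (simp add: T_def[abs_def])
  also have "real \<delta> * P / s * E s + P * (- 2 * real \<delta> * (1 - s\<^sup>2) / s * (K1 s)\<^sup>2)
      + real \<delta> * ((real \<delta> * P / s * s - P) / s\<^sup>2 * ((1 - s\<^sup>2) * (K s * K1 s))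
      + ((- 2 * s) * (K s * K1 s) + (1 - s\<^sup>2) * (K1 s)\<^sup>2 + K s * ((1 - s\<^sup>2) * K2 s)) * (P / s))
      = - real \<delta> * P / s\<^sup>2 * (K s * K1 s)"
    unfolding ode_pos[OF assms] E_def using assms
    by (simp add: field_simps) (simp add: algebra_simps eval_nat_numeral)
  finally show ?thesis by (simp add: P_def)
qed

lemma KK1_bound:
  assumes "0 \<le> (s::real)" "2 * s\<^sup>2 \<le> 1"
  shows "4 * \<mu> * \<bar>K s * K1 s\<bar> \<le> 3 * E s"
proof -
  have s: "s \<le> 1" using assms by (simp add: power2_le_imp_le[of s 1])
  \<comment> \<open>Weighted AM-GM. The weights 3 and 2 absorb the factor 2 lost in
    \<open>(K1 s)\<^sup>2 \<le> 2 * (1 - s\<^sup>2) * (K1 s)\<^sup>2\<close>, because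
    \<open>2 * 2\<^sup>2 \<le> 3\<^sup>2\<close>.\<close>
  have "0 \<le> (3 * \<mu> * \<bar>K s\<bar> - 2 * \<bar>K1 s\<bar>)\<^sup>2" by simp
  then have "12 * \<mu> * \<bar>K s * K1 s\<bar> \<le> 9 * (\<mu>\<^sup>2 * (K s)\<^sup>2) + 4 * (K1 s)\<^sup>2"
    by (simp add: power2_diff power_mult_distrib abs_mult algebra_simps)
  moreover have "1/2 * (K1 s)\<^sup>2 \<le> (1 - s\<^sup>2) * (K1 s)\<^sup>2"
    using assms by (intro mult_right_mono) auto
  moreover have "0 \<le> (K1 s)\<^sup>2" by simp
  ultimately show ?thesis unfolding E_def by argo
qed

text \<open>Gronwall's argument for \<open>T\<close>: beyond a distance of order
  \<open>1 / \<mu>\<close> from the pole, \<open>s ^ \<delta> * E\<close> can grow by at most the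
  factor 5.\<close>

lemma decay_mid:
  assumes "3 * (real \<delta> + 1) / \<mu> \<le> s" "2 * s\<^sup>2 \<le> 1"
  shows "s ^ \<delta> * E s \<le> 5 * (3 * (real \<delta> + 1) / \<mu>) ^ \<delta> * \<mu>\<^sup>2"
proof -
  \<comment> \<open>From this point on \<open>3 * \<delta> / (\<mu> * x) \<le> 1\<close>, which
    makes \<open>B\<close> at most a quarter of \<open>x ^ \<delta> * E x\<close>.\<close>
  define a where "a = 3 * (real \<delta> + 1) / \<mu>"
  have a: "a > 0" "a \<le> s" using freq_pos assms by (auto simp: a_def)
  have bounds: "\<bar>B x\<bar> \<le> x ^ \<delta> * E x / 4"
      "\<bar>real \<delta> * x ^ \<delta> / x\<^sup>2 * (K x * K1 x)\<bar> \<le> real \<delta> / (\<mu> * x\<^sup>2) * T x"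
    if x: "a \<le> x" "x \<le> s" for x
  proof -
    have x0: "x > 0" using a x by simp
    have "x\<^sup>2 \<le> s\<^sup>2" using x x0 by (intro power_mono) auto
    then have x2: "2 * x\<^sup>2 \<le> 1" using assms by simp
    have x1: "x \<le> 1" using x2 x0 by (simp add: power2_le_imp_le[of x 1])
    have KK: "\<bar>K x * K1 x\<bar> \<le> 3 / (4 * \<mu>) * E x"
      using KK1_bound[of x] x2 x0 freq_pos by (simp add: field_simps)
    have ax: "3 * (real \<delta> + 1) \<le> \<mu> * x" using x(1) freq_pos by (simp add: a_def field_simps)
    have "\<bar>B x\<bar> = real \<delta> * x ^ \<delta> / x * (1 - x\<^sup>2) * \<bar>K x * K1 x\<bar>"
      using x0 x2 by (simp add: B_def abs_mult)
    also have "\<dots> \<le> real \<delta> * x ^ \<delta> / x * 1 * (3 / (4 * \<mu>) * E x)"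
      using x0 x2 KK by (intro mult_mono) auto
    also have "\<dots> = 3 * real \<delta> / (\<mu> * x) * (x ^ \<delta> * E x / 4)"
      using x0 freq_pos by (simp add: field_simps)
    also have "\<dots> \<le> 1 * (x ^ \<delta> * E x / 4)"
      using x0 freq_pos ax E_ge(3)[of x] x1 by (intro mult_right_mono) (auto simp: field_simps)
    finally show B: "\<bar>B x\<bar> \<le> x ^ \<delta> * E x / 4" by simp
    have TE: "3 / 4 * (x ^ \<delta> * E x) \<le> T x" using B unfolding T_def by argo
    have "\<bar>real \<delta> * x ^ \<delta> / x\<^sup>2 * (K x * K1 x)\<bar> = real \<delta> * x ^ \<delta> / x\<^sup>2 * \<bar>K x * K1 x\<bar>"
      using x0 by (simp add: abs_mult)
    also have "\<dots> \<le> real \<delta> * x ^ \<delta> / x\<^sup>2 * (3 / (4 * \<mu>) * E x)"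
      using x0 KK by (intro mult_left_mono) auto
    also have "\<dots> = real \<delta> / (\<mu> * x\<^sup>2) * (3 / 4 * (x ^ \<delta> * E x))"
      using x0 freq_pos by (simp add: field_simps)
    also have "\<dots> \<le> real \<delta> / (\<mu> * x\<^sup>2) * T x"
      using x0 freq_pos TE by (intro mult_left_mono) auto
    finally show "\<bar>real \<delta> * x ^ \<delta> / x\<^sup>2 * (K x * K1 x)\<bar> \<le> real \<delta> / (\<mu> * x\<^sup>2) * T x" .
  qed
  \<comment> \<open>The exponent is an antiderivative of
    \<open>- \<delta> / (\<mu> * x\<^sup>2)\<close>, the negative of the growth rate allowed by the
    second bound.\<close>
  have "T s * exp (real \<delta> / (\<mu> * s)) \<le> T a * exp (real \<delta> / (\<mu> * a))"
  proof (rule DERIV_nonpos_imp_nonincreasing[OF a(2)])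
    fix x assume x: "a \<le> x" "x \<le> s"
    then have x0: "x > 0" using a by simp
    have "((\<lambda>x. real \<delta> / (\<mu> * x)) has_real_derivative - real \<delta> / (\<mu> * x\<^sup>2)) (at x)"
      using x0 freq_pos by (auto intro!: derivative_eq_intros simp: power2_eq_square)
    then have "((\<lambda>x. exp (real \<delta> / (\<mu> * x))) has_real_derivative
        exp (real \<delta> / (\<mu> * x)) * (- real \<delta> / (\<mu> * x\<^sup>2))) (at x)"
      by (rule DERIV_fun_exp)
    from DERIV_mult[OF DERIV_T[OF x0] this]
    have "((\<lambda>x. T x * exp (real \<delta> / (\<mu> * x))) has_real_derivative
        (- real \<delta> * x ^ \<delta> / x\<^sup>2 * (K x * K1 x)) * exp (real \<delta> / (\<mu> * x))
        + T x * (exp (real \<delta> / (\<mu> * x)) * (- real \<delta> / (\<mu> * x\<^sup>2)))) (at x)"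
      by (simp add: algebra_simps)
    moreover have "(- real \<delta> * x ^ \<delta> / x\<^sup>2 * (K x * K1 x)) * exp (real \<delta> / (\<mu> * x))
        + T x * (exp (real \<delta> / (\<mu> * x)) * (- real \<delta> / (\<mu> * x\<^sup>2)))
        = exp (real \<delta> / (\<mu> * x)) *
          (- (real \<delta> * x ^ \<delta> / x\<^sup>2 * (K x * K1 x)) - real \<delta> / (\<mu> * x\<^sup>2) * T x)"
      by (simp add: algebra_simps)
    moreover have "- (real \<delta> * x ^ \<delta> / x\<^sup>2 * (K x * K1 x)) - real \<delta> / (\<mu> * x\<^sup>2) * T x \<le> 0"
      using bounds(2)[OF x] by linarith
    ultimately show "\<exists>y. ((\<lambda>x. T x * exp (real \<delta> / (\<mu> * x))) has_real_derivative y) (at x) \<and> y \<le> 0"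
      by (intro exI conjI) (auto simp: mult_le_0_iff)
  qed
  moreover have "exp (real \<delta> / (\<mu> * a)) \<le> 3"
  proof -
    have "real \<delta> / (\<mu> * a) \<le> 1" using freq_pos by (simp add: a_def)
    then have "exp (real \<delta> / (\<mu> * a)) \<le> exp 1" by simp
    then show ?thesis using exp_le by linarith
  qed
  moreover have Tpos: "0 \<le> 3 / 4 * (x ^ \<delta> * E x)" "3 / 4 * (x ^ \<delta> * E x) \<le> T x"
      "T x \<le> 5 / 4 * (x ^ \<delta> * E x)" if "a \<le> x" "x \<le> s" for x
  proof -
    have "x\<^sup>2 \<le> s\<^sup>2" using that a by (intro power_mono) auto
    then have "x \<le> 1" using assms by (intro power2_le_imp_le[of x 1]) auto
    then show "0 \<le> 3 / 4 * (x ^ \<delta> * E x)" using E_ge(3)[of x] that a by simp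
    show "3 / 4 * (x ^ \<delta> * E x) \<le> T x" "T x \<le> 5 / 4 * (x ^ \<delta> * E x)"
      using bounds(1)[OF that] unfolding T_def by argo+
  qed
  moreover have "T s \<le> T s * exp (real \<delta> / (\<mu> * s))"
    using Tpos[of s] a freq_pos mult_left_mono[of 1 "exp (real \<delta> / (\<mu> * s))" "T s"] by simp
  moreover have "T a * exp (real \<delta> / (\<mu> * a)) \<le> T a * 3"
    using Tpos[of a] a calculation(2) by (intro mult_left_mono) auto
  \<comment> \<open>The factor is \<open>3 * (5 / 4) / (3 / 4)\<close>: the exponential, then
    \<open>T\<close> against \<open>s ^ \<delta> * E\<close> at both ends.\<close>
  ultimately have "s ^ \<delta> * E s \<le> 5 * (a ^ \<delta> * E a)"
    using Tpos[of a] Tpos[of s] a by linarith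
  also have "\<dots> \<le> 5 * (a ^ \<delta> * \<mu>\<^sup>2)"
  proof -
    have "s \<le> 1" using assms by (intro power2_le_imp_le[of s 1]) auto
    then show ?thesis using E_le[of a] a by (intro mult_left_mono) auto
  qed
  finally show ?thesis by (simp add: a_def mult.assoc)
qed

text \<open>Close to the pole \<open>(K s)\<^sup>2 \<le> 1\<close> suffices, and
  \<open>decay_mid\<close> covers the middle. Near the equator the energy no longer controls
  \<open>K1\<close>, so its monotonicity takes over; this costs \<open>2 ^ \<delta>\<close> and
  turns the 3 into a 6.\<close>

lemma decay:
  assumes "0 \<le> s" "s \<le> 1"
  shows "s ^ \<delta> * (K s)\<^sup>2 \<le> 5 * (6 * (real \<delta> + 1) / \<mu>) ^ \<delta>"
proof -
  define a where "a = 3 * (real \<delta> + 1) / \<mu>"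
  have a: "a > 0" using freq_pos by (simp add: a_def)
  have goal: "?thesis \<longleftrightarrow> s ^ \<delta> * (K s)\<^sup>2 \<le> 5 * (2 * a) ^ \<delta>" unfolding a_def by simp
  have K1: "(K s)\<^sup>2 \<le> 1" using K_sq_le_1 assms by blast
  have mono: "a ^ \<delta> \<le> (2 * a) ^ \<delta>" using a by (intro power_mono) auto
  have KE: "\<mu>\<^sup>2 * (s ^ \<delta> * (K s)\<^sup>2) \<le> s ^ \<delta> * E s"
    using E_ge(1)[OF assms] assms mult_left_mono[of "\<mu>\<^sup>2 * (K s)\<^sup>2" "E s" "s ^ \<delta>"]
    by (simp add: algebra_simps)
  consider "s \<le> a" | "a \<le> s" "2 * s\<^sup>2 \<le> 1" | "a \<le> s" "2 * s\<^sup>2 > 1" by linarith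
  then show ?thesis
  proof cases
    case 1
    then have "s ^ \<delta> * (K s)\<^sup>2 \<le> a ^ \<delta> * 1" using K1 assms a by (intro mult_mono power_mono) auto
    then show ?thesis unfolding goal using mono a zero_le_power[of a \<delta>] by linarith
  next
    case 2
    then have "\<mu>\<^sup>2 * (s ^ \<delta> * (K s)\<^sup>2) \<le> \<mu>\<^sup>2 * (5 * a ^ \<delta>)"
      using decay_mid[of s] KE by (simp add: a_def mult_ac)
    then have "s ^ \<delta> * (K s)\<^sup>2 \<le> 5 * a ^ \<delta>" using freq_pos by simp
    then show ?thesis unfolding goal using mono by linarith
  next
    case 3
    \<comment> \<open>The last point at which \<open>decay_mid\<close> applies. If \<open>a\<close>
      lies beyond it, then \<open>2 * a \<ge> 1\<close> and the right-hand side already exceeds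
      1.\<close>
    define r :: real where "r = sqrt (1/2)"
    have r: "r > 0" "r\<^sup>2 = 1/2" "r \<le> 1"
      unfolding r_def by (simp, subst real_sqrt_pow2) simp_all
    have rs: "r \<le> s" by (rule power2_le_imp_le) (use 3 r assms in linarith)+
    have "1\<^sup>2 \<le> (2 * r)\<^sup>2" unfolding power_mult_distrib using r(2) by simp
    then have r2: "1 \<le> 2 * r" by (rule power2_le_imp_le) (use r in simp)
    have s1: "s ^ \<delta> * (K s)\<^sup>2 \<le> (K s)\<^sup>2"
      using assms by (intro mult_left_le_one_le) (auto simp: power_le_one)
    show ?thesis
    proof (cases "a \<le> r")
      case True
      have "\<mu>\<^sup>2 * (K s)\<^sup>2 \<le> E r"
        using E_ge(1)[OF assms] E_antimono[of r s] rs r assms by linarith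
      also have "E r \<le> (2 * r) ^ \<delta> * E r"
        using E_ge(3)[of r] r mult_right_mono[OF one_le_power[OF r2, of \<delta>], of "E r"] by simp
      also have "\<dots> = 2 ^ \<delta> * (r ^ \<delta> * E r)" by (simp add: power_mult_distrib)
      also have "\<dots> \<le> 2 ^ \<delta> * (5 * a ^ \<delta> * \<mu>\<^sup>2)"
        using decay_mid[of r] True r by (intro mult_left_mono) (auto simp: a_def)
      finally have "\<mu>\<^sup>2 * (K s)\<^sup>2 \<le> \<mu>\<^sup>2 * (5 * (2 * a) ^ \<delta>)"
        by (simp add: power_mult_distrib mult_ac)
      then have "(K s)\<^sup>2 \<le> 5 * (2 * a) ^ \<delta>" using freq_pos by simp
      then show ?thesis unfolding goal using s1 by linarith
    next
      case False
      then have "1 \<le> (2 * a) ^ \<delta>" using r2 by (intro one_le_power) linarith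
      then show ?thesis unfolding goal using s1 K1 by linarith
    qed
  qed
qed

end

lemma zonal_profile_poly:
  fixes d m :: nat
  assumes "d \<ge> 1" "m \<ge> 1"
  defines "H \<equiv> zonal_poly d m"
  shows "zonal_profile (d - 1) (zonal_freq d m) (\<lambda>s. poly H (s\<^sup>2)) (\<lambda>s. 2 * s * poly (pderiv H) (s\<^sup>2))
     (\<lambda>s. 2 * poly (pderiv H) (s\<^sup>2) + 4 * s\<^sup>2 * poly (pderiv (pderiv H)) (s\<^sup>2))"
proof
  show "zonal_freq d m > 0" using assms by (auto simp: zonal_freq_def intro!: mult_pos_pos)
  fix s :: real
  have D: "((\<lambda>s. poly p (s\<^sup>2)) has_real_derivative 2 * s * poly (pderiv p) (s\<^sup>2)) (at s)" for p :: "real poly"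
    by (auto intro!: derivative_eq_intros DERIV_chain2[OF poly_DERIV])
  show "((\<lambda>s. poly H (s\<^sup>2)) has_real_derivative 2 * s * poly (pderiv H) (s\<^sup>2)) (at s)"
    by (rule D)
  show "((\<lambda>s. 2 * s * poly (pderiv H) (s\<^sup>2)) has_real_derivative
      2 * poly (pderiv H) (s\<^sup>2) + 4 * s\<^sup>2 * poly (pderiv (pderiv H)) (s\<^sup>2)) (at s)"
    by (auto intro!: derivative_eq_intros D simp: power2_eq_square)
  \<comment> \<open>The equation at \<open>w = s\<^sup>2\<close>, multiplied by \<open>s\<close>,
    rearranges to the one in the locale.\<close>
  have "s * (4 * s\<^sup>2 * (1 - s\<^sup>2) * poly (pderiv (pderiv H)) (s\<^sup>2)
     + (2 * real d - (2 * real d + 2) * s\<^sup>2) * poly (pderiv H) (s\<^sup>2)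
     + (zonal_freq d m)\<^sup>2 * poly H (s\<^sup>2)) = 0"
    using poly_zonal_ode[OF assms(1), of "s\<^sup>2" m] by (simp add: H_def)
  then show "s * (1 - s\<^sup>2) * (2 * poly (pderiv H) (s\<^sup>2) + 4 * s\<^sup>2 * poly (pderiv (pderiv H)) (s\<^sup>2))
     + (real (d - 1) * (1 - s\<^sup>2) - s\<^sup>2) * (2 * s * poly (pderiv H) (s\<^sup>2))
     + (zonal_freq d m)\<^sup>2 * s * poly H (s\<^sup>2) = 0"
    using assms by (simp add: of_nat_diff algebra_simps)
qed (simp_all add: H_def poly_zonal_0)

section \<open>The measure of the sphere\<close>

lemma emeasure_lborel_orthogonal_vimage:
  fixes f :: "'a::euclidean_space \<Rightarrow> 'a"
  assumes f: "orthogonal_transformation f" and A: "A \<in> sets borel"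
  shows "emeasure lborel (f -` A) = emeasure lborel A"
proof -
  have f_meas[measurable]: "f \<in> borel_measurable borel"
    using f by (intro borel_measurable_continuous_onI linear_continuous_on)
      (simp add: orthogonal_transformation_def linear_conv_bounded_linear)
  have add: "f (x + y) = f x + f y" for x y
    using f by (simp add: orthogonal_transformation_def linear_add)
  have norm: "norm (f x) = norm x" for x
    using f by (rule orthogonal_transformation_norm)
  have trans: "(\<integral>\<^sup>+y. g (c + y) \<partial>lborel) = (\<integral>\<^sup>+y. g y \<partial>lborel)"
    if [measurable]: "g \<in> borel_measurable borel" for g :: "'a \<Rightarrow> ennreal" and c
    using nn_integral_distr[of "(+) c" lborel borel g] by (simp add: lborel_distr_plus)
  note [measurable] = A
  \<comment> \<open>Uniqueness of Haar measure: integrate \<open>1\<^sub>A (f x) 1\<^sub>U (y - f x)\<close> in both orders, with \<open>U\<close> invariant under \<open>f\<close>.\<close>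
  define U where "U = (ball 0 1 :: 'a set)"
  have [measurable]: "U \<in> sets borel" by (simp add: U_def)
  have "emeasure lborel (f -` A) * emeasure lborel U
      = (\<integral>\<^sup>+x. indicator A (f x) * emeasure lborel U \<partial>lborel)"
    using measurable_sets_borel[OF f_meas A]
    by (subst nn_integral_multc) (simp_all flip: indicator_vimage)
  also have "\<dots> = (\<integral>\<^sup>+x. (\<integral>\<^sup>+y. indicator A (f x) * indicator U (y - f x) \<partial>lborel) \<partial>lborel)"
    using trans[of "indicator U" "- f x" for x] by (simp add: nn_integral_cmult)
  also have "\<dots> = (\<integral>\<^sup>+y. (\<integral>\<^sup>+x. indicator A (f x) * indicator U (y - f x) \<partial>lborel) \<partial>lborel)"
    by (rule lborel_pair.Fubini') simp
  also have "\<dots> = (\<integral>\<^sup>+y. (\<integral>\<^sup>+x. indicator A (f x + y) * indicator U x \<partial>lborel) \<partial>lborel)"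
  proof (rule nn_integral_cong)
    fix y
    obtain z where z: "f z = y" using orthogonal_transformation_surj[OF f] by (metis surjD)
    have "indicator U (y - f (z + x)) = (indicator U x :: ennreal)" for x
      by (simp add: indicator_def add z U_def norm)
    then show "(\<integral>\<^sup>+x. indicator A (f x) * indicator U (y - f x) \<partial>lborel)
        = (\<integral>\<^sup>+x. indicator A (f x + y) * indicator U x \<partial>lborel)"
      using trans[of "\<lambda>x. indicator A (f x) * indicator U (y - f x)" z]
      by (simp add: add z add.commute)
  qed
  also have "\<dots> = (\<integral>\<^sup>+x. (\<integral>\<^sup>+y. indicator A (f x + y) * indicator U x \<partial>lborel) \<partial>lborel)"
    by (rule lborel_pair.Fubini') simp
  also have "\<dots> = (\<integral>\<^sup>+x. emeasure lborel A * indicator U x \<partial>lborel)"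
  proof (rule nn_integral_cong)
    fix x
    show "(\<integral>\<^sup>+y. indicator A (f x + y) * indicator U x \<partial>lborel) = emeasure lborel A * indicator U x"
      using trans[of "indicator A" "f x"] by (simp add: nn_integral_multc)
  qed
  also have "\<dots> = emeasure lborel A * emeasure lborel U"
    by (simp add: nn_integral_cmult)
  finally have eq: "emeasure lborel U * emeasure lborel (f -` A) = emeasure lborel U * emeasure lborel A"
    by (simp add: mult.commute)
  have "emeasure lborel U \<noteq> \<infinity>" using emeasure_lborel_ball_finite[of "0::'a" 1] by (auto simp: U_def)
  moreover have "emeasure lborel U \<noteq> 0"
    using content_ball_pos[of 1 "0::'a"] by (auto simp: U_def measure_def)
  ultimately show ?thesis using eq by (simp add: ennreal_mult_cancel_left)
qed

lemma space_sphere_measure [simp]: "space sphere_measure = sphere 0 1"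
  by (simp add: sphere_measure_def space_scale_measure space_restrict_space)

lemma sets_sphere_measure [simp, measurable_cong]: "sets sphere_measure = sets (restrict_space borel (sphere 0 1))"
  by (simp add: sphere_measure_def)

lemma emeasure_sphere_measure:
  fixes A :: "'a::euclidean_space set"
  assumes "A \<in> sets borel" "A \<subseteq> sphere 0 1"
  shows "emeasure sphere_measure A
    = of_nat DIM('a) * emeasure lborel {y \<in> cball 0 1 - {0}. y /\<^sub>R norm y \<in> A}"
proof -
  have A: "A \<in> sets (restrict_space borel (sphere 0 1))"
    using assms by (auto simp: sets_restrict_space)
  have "(\<lambda>y::'a. y /\<^sub>R norm y) \<in> restrict_space lborel (cball 0 1 - {0}) \<rightarrow>\<^sub>M restrict_space borel (sphere 0 1)"
    by (intro measurable_restrict_space2 measurable_restrict_space1) (auto simp: space_restrict_space)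
  then have "emeasure sphere_measure A = of_nat DIM('a) * emeasure (restrict_space lborel (cball 0 1 - {0}))
     ((\<lambda>y. y /\<^sub>R norm y) -` A \<inter> space (restrict_space lborel (cball 0 1 - {0})))"
    by (simp add: sphere_measure_def emeasure_distr A)
  also have "(\<lambda>y. y /\<^sub>R norm y) -` A \<inter> space (restrict_space lborel (cball 0 1 - {0}))
      = {y \<in> cball 0 1 - {0}. y /\<^sub>R norm y \<in> A}"
    by (auto simp: space_restrict_space)
  finally show ?thesis by (subst (asm) emeasure_restrict_space) auto
qed

lemma sets_cone:
  assumes "A \<in> sets borel"
  shows "{y \<in> cball 0 1 - {0::'a::euclidean_space}. y /\<^sub>R norm y \<in> A} \<in> sets borel"
proof -
  have "(\<lambda>y::'a. y /\<^sub>R norm y) \<in> borel_measurable borel" by measurable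
  from measurable_sets_borel[OF this assms]
  have "(cball 0 1 - {0}) \<inter> (\<lambda>y::'a. y /\<^sub>R norm y) -` A \<in> sets borel" by (intro sets.Int) auto
  also have "(cball 0 1 - {0}) \<inter> (\<lambda>y::'a. y /\<^sub>R norm y) -` A = {y \<in> cball 0 1 - {0}. y /\<^sub>R norm y \<in> A}"
    by auto
  finally show ?thesis .
qed

lemma finite_measure_sphere: "finite_measure (sphere_measure :: 'a::euclidean_space measure)"
proof
  have "emeasure lborel {y \<in> cball 0 1 - {0::'a}. y /\<^sub>R norm y \<in> sphere 0 1} \<le> emeasure lborel (cball (0::'a) 1)"
    by (intro emeasure_mono) auto
  also have "\<dots> < \<infinity>" using emeasure_bounded_finite[of "cball (0::'a) 1"] by simp
  finally show "emeasure sphere_measure (space (sphere_measure :: 'a measure)) \<noteq> \<infinity>"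
    by (simp add: emeasure_sphere_measure ennreal_mult_eq_top_iff)
qed

text \<open>A linear isometry commutes with normalising a vector, so the cone over a preimage is the
  preimage of the cone, and the invariance of Lebesgue measure carries over.\<close>

lemma distr_sphere_measure_orthogonal:
  fixes f :: "'a::euclidean_space \<Rightarrow> 'a"
  assumes f: "orthogonal_transformation f"
  shows "f \<in> sphere_measure \<rightarrow>\<^sub>M sphere_measure" "distr sphere_measure sphere_measure f = sphere_measure"
proof -
  have f_borel[measurable]: "f \<in> borel_measurable borel"
    using f by (intro borel_measurable_continuous_onI linear_continuous_on)
      (simp add: orthogonal_transformation_def linear_conv_bounded_linear)
  have norm: "norm (f x) = norm x" for x
    using f by (rule orthogonal_transformation_norm)
  show meas: "f \<in> sphere_measure \<rightarrow>\<^sub>M sphere_measure"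
    unfolding measurable_cong_sets[OF sets_sphere_measure sets_sphere_measure]
    by (intro measurable_restrict_space2 measurable_restrict_space1) (auto simp: space_restrict_space norm)
  show "distr sphere_measure sphere_measure f = sphere_measure"
  proof (rule measure_eqI)
    fix A assume "A \<in> sets (distr sphere_measure sphere_measure f)"
    then have A: "A \<in> sets borel" "A \<subseteq> sphere 0 1" and A': "A \<in> sets sphere_measure"
      by (auto simp: sets_restrict_space)
    have fA: "f -` A \<subseteq> sphere 0 1" using A norm by auto
    have fA': "f -` A \<in> sets borel" using measurable_sets_borel[OF f_borel A(1)] by simp
    let ?C = "\<lambda>A. {y \<in> cball 0 1 - {0}. y /\<^sub>R norm y \<in> A}"
    have "emeasure (distr sphere_measure sphere_measure f) A = emeasure sphere_measure (f -` A)"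
      using emeasure_distr[OF meas A'] fA by (simp add: Int_absorb2)
    also have "\<dots> = of_nat DIM('a) * emeasure lborel (?C (f -` A))"
      by (rule emeasure_sphere_measure[OF fA' fA])
    also have "?C (f -` A) = f -` ?C A"
      using norm f by (auto simp: orthogonal_transformation_scaleR) (metis norm_eq_zero)+
    also have "emeasure lborel (f -` ?C A) = emeasure lborel (?C A)"
      by (intro emeasure_lborel_orthogonal_vimage f sets_cone A)
    also have "of_nat DIM('a) * emeasure lborel (?C A) = emeasure sphere_measure A"
      by (rule emeasure_sphere_measure[OF A, symmetric])
    finally show "emeasure (distr sphere_measure sphere_measure f) A = emeasure sphere_measure A" .
  qed simp
qed

lemma integral_sphere_orthogonal:
  fixes f :: "'a::euclidean_space \<Rightarrow> 'a" and g :: "'a \<Rightarrow> real"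
  assumes "orthogonal_transformation f" "g \<in> borel_measurable sphere_measure"
  shows "(LINT x|sphere_measure. g (f x)) = (LINT x|sphere_measure. g x)"
  using integral_distr[OF distr_sphere_measure_orthogonal(1)[OF assms(1)] assms(2)]
  by (simp add: distr_sphere_measure_orthogonal(2)[OF assms(1)])

lemma borel_measurable_sphere:
  fixes g :: "'a::euclidean_space \<Rightarrow> 'b::topological_space"
  shows "continuous_on (sphere 0 1) g \<Longrightarrow> g \<in> borel_measurable sphere_measure"
  unfolding measurable_cong_sets[OF sets_sphere_measure refl]
  by (rule borel_measurable_continuous_on_restrict)

lemma integrable_sphere:
  fixes g :: "'a::euclidean_space \<Rightarrow> 'b::{banach, second_countable_topology}"
  assumes "continuous_on (sphere 0 1) g"
  shows "integrable sphere_measure g"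
proof -
  interpret finite_measure "sphere_measure :: 'a measure" by (rule finite_measure_sphere)
  have "compact (g ` sphere 0 1)" using assms by (intro compact_continuous_image) auto
  then obtain B where "\<And>x. x \<in> sphere 0 1 \<Longrightarrow> norm (g x) \<le> B"
    using compact_imp_bounded bounded_iff by (metis imageI)
  then show ?thesis
    using borel_measurable_sphere[OF assms] by (intro integrable_const_bound[of _ B]) auto
qed


section \<open>Polar caps and their measure\<close>

text \<open>For unit vectors this is the sine of the angle between \<open>x\<close> and the axis
  through \<open>b\<close>; it does not distinguish the two poles, so the caps below come in
  antipodal pairs.\<close>

definition perp :: "'a::euclidean_space \<Rightarrow> 'a \<Rightarrow> real" where
  "perp b x = norm (x - (x \<bullet> b) *\<^sub>R b)"

lemma perp_nonneg [simp]: "0 \<le> perp b x"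
  by (simp add: perp_def)

lemma perp_scaleR: "perp b (c *\<^sub>R x) = \<bar>c\<bar> * perp b x"
proof -
  have "c *\<^sub>R x - ((c *\<^sub>R x) \<bullet> b) *\<^sub>R b = c *\<^sub>R (x - (x \<bullet> b) *\<^sub>R b)"
    by (simp add: algebra_simps)
  then show ?thesis by (simp add: perp_def)
qed

lemma perp_sq:
  assumes "b \<in> Basis" "norm x = 1"
  shows "(perp b x)\<^sup>2 = 1 - (x \<bullet> b)\<^sup>2"
proof -
  have "(perp b x)\<^sup>2 = x \<bullet> x - 2 * (x \<bullet> b) * (x \<bullet> b) + (x \<bullet> b) * (x \<bullet> b) * (b \<bullet> b)"
    unfolding perp_def power2_norm_eq_inner
    by (simp add: inner_diff_left inner_diff_right inner_commute[of b x] algebra_simps)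
  also have "\<dots> = 1 - (x \<bullet> b)\<^sup>2"
  proof -
    have "x \<bullet> x = 1" using assms(2) norm_eq_1 by blast
    moreover have "b \<bullet> b = 1" using assms(1) by (rule inner_same_Basis)
    ultimately show ?thesis by algebra
  qed
  finally show ?thesis .
qed

lemma perp_le_1:
  assumes "b \<in> Basis" "norm x = 1"
  shows "perp b x \<le> 1"
proof (rule power2_le_imp_le)
  show "(perp b x)\<^sup>2 \<le> 1\<^sup>2" unfolding perp_sq[OF assms] by simp
qed simp

lemma continuous_on_perp: "continuous_on A (perp b)"
  unfolding perp_def by (intro continuous_intros)

lemma abs_inner_le_perp:
  assumes "b \<in> Basis" "i \<in> Basis" "i \<noteq> b"
  shows "\<bar>x \<bullet> i\<bar> \<le> perp b x"
proof -
  have "x \<bullet> i = (x - (x \<bullet> b) *\<^sub>R b) \<bullet> i"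
    using assms by (simp add: inner_diff_left inner_Basis)
  then show ?thesis using Basis_le_norm[OF assms(2)] unfolding perp_def by metis
qed

lemma perp_le_sum:
  assumes "b \<in> Basis"
  shows "perp b x \<le> (\<Sum>i\<in>Basis - {b}. \<bar>x \<bullet> i\<bar>)"
proof -
  have "perp b x \<le> (\<Sum>i\<in>Basis. \<bar>(x - (x \<bullet> b) *\<^sub>R b) \<bullet> i\<bar>)"
    unfolding perp_def by (rule norm_le_l1)
  also have "\<dots> = (\<Sum>i\<in>Basis - {b}. \<bar>x \<bullet> i\<bar>)"
  proof -
    have "\<bar>(x - (x \<bullet> b) *\<^sub>R b) \<bullet> i\<bar> = (if i = b then 0 else \<bar>x \<bullet> i\<bar>)" if "i \<in> Basis" for i
      using that assms by (auto simp: inner_diff_left inner_Basis)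
    then have "(\<Sum>i\<in>Basis. \<bar>(x - (x \<bullet> b) *\<^sub>R b) \<bullet> i\<bar>) = (\<Sum>i\<in>Basis. if i = b then 0 else \<bar>x \<bullet> i\<bar>)"
      by (rule sum.cong[OF refl])
    also have "\<dots> = (\<Sum>i\<in>Basis - {b}. \<bar>x \<bullet> i\<bar>)"
      using assms by (subst sum.remove[of _ b]) (auto intro!: sum.cong)
    finally show ?thesis .
  qed
  finally show ?thesis .
qed

lemma prod_Basis_if:
  fixes b :: "'a::euclidean_space" and x y :: real
  assumes "b \<in> Basis"
  shows "(\<Prod>i\<in>Basis. if i = b then x else y) = x * y ^ (DIM('a) - 1)"
proof -
  have "(\<Prod>i\<in>Basis - {b}. if i = b then x else y) = (\<Prod>i\<in>Basis - {b}. y)"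
    by (intro prod.cong) auto
  then show ?thesis using assms by (subst prod.remove[of _ b]) auto
qed

lemma perp_le_sets:
  shows "{x \<in> sphere 0 1. perp b x \<le> r} \<in> sets borel"
    "{x \<in> sphere 0 1. perp b x \<le> r} \<subseteq> sphere 0 1"
  using closed_Collect_le[OF continuous_on_perp continuous_on_const, of b r]
  by (auto simp: Collect_conj_eq intro!: sets.Int borel_closed)

text \<open>The cone over the cap fits into a box of side 2 along \<open>b\<close> and
  \<open>2 * r\<close> in the other directions.\<close>

lemma emeasure_cap_le:
  fixes b :: "'a::euclidean_space" and r :: real
  assumes "b \<in> Basis" "0 \<le> r"
  shows "emeasure sphere_measure {x \<in> sphere 0 1. perp b x \<le> r}
    \<le> ennreal (2 * real DIM('a) * (2 * r) ^ (DIM('a) - 1))"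
proof -
  define u where "u = (\<Sum>i\<in>Basis. (if i = b then 1 else r) *\<^sub>R i)"
  have u: "u \<bullet> i = (if i = b then 1 else r)" if "i \<in> Basis" for i
    using that by (simp add: u_def)
  have "{y \<in> cball 0 1 - {0}. y /\<^sub>R norm y \<in> {x \<in> sphere 0 1. perp b x \<le> r}} \<subseteq> cbox (- u) u"
  proof (intro subsetI)
    fix y assume y: "y \<in> {y \<in> cball 0 1 - {0}. y /\<^sub>R norm y \<in> {x \<in> sphere 0 1. perp b x \<le> r}}"
    have "\<bar>y \<bullet> i\<bar> \<le> u \<bullet> i" if i: "i \<in> Basis" for i
    proof (cases "i = b")
      case True
      then show ?thesis using y Basis_le_norm[OF i, of y] i by (simp add: u)
    next
      case False
      have "perp b y / norm y \<le> r" "y \<noteq> 0" using y by (auto simp: perp_scaleR divide_inverse mult.commute)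
      then have "perp b y \<le> r * norm y" by (simp add: pos_divide_le_eq)
      also have "\<dots> \<le> r" using y assms by (simp add: mult_left_le)
      finally show ?thesis using False abs_inner_le_perp[OF assms(1) i False, of y] by (simp add: u i)
    qed
    then show "y \<in> cbox (- u) u" by (auto simp: mem_box abs_le_iff minus_le_iff)
  qed
  then have "emeasure sphere_measure {x \<in> sphere 0 1. perp b x \<le> r}
      \<le> of_nat DIM('a) * emeasure lborel (cbox (- u) u)"
    by (subst emeasure_sphere_measure[OF perp_le_sets]) (intro mult_left_mono emeasure_mono; simp)
  also have "emeasure lborel (cbox (- u) u) = ennreal (\<Prod>i\<in>Basis. (u - - u) \<bullet> i)"
    using assms by (intro emeasure_lborel_cbox) (auto simp: u)
  also have "(\<Prod>i\<in>Basis. (u - - u) \<bullet> i) = (\<Prod>i\<in>Basis. if i = b then 2 else 2 * r)"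
    by (intro prod.cong) (auto simp: u inner_add_left)
  also have "\<dots> = 2 * (2 * r) ^ (DIM('a) - 1)"
    by (rule prod_Basis_if[OF assms(1)])
  also have "of_nat DIM('a) * ennreal (2 * (2 * r) ^ (DIM('a) - 1))
      = ennreal (2 * real DIM('a) * (2 * r) ^ (DIM('a) - 1))"
    unfolding ennreal_of_nat_eq_real_of_nat by (subst ennreal_mult'[symmetric]) (simp_all only: of_nat_0_le_iff mult_ac)
  finally show ?thesis .
qed

text \<open>The cone over the cap contains a box of side 1/4 along \<open>b\<close> and
  \<open>r / (2 * n)\<close> in the other directions.\<close>

lemma emeasure_cap_ge:
  fixes b :: "'a::euclidean_space" and r :: real
  assumes "b \<in> Basis" "0 \<le> r" "r \<le> 1"
  shows "ennreal (1 / 4 * (r / (2 * real DIM('a))) ^ (DIM('a) - 1))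
    \<le> emeasure sphere_measure {x \<in> sphere 0 1. perp b x \<le> r}"
proof -
  define n where "n = real DIM('a)"
  have n: "n \<ge> 1" by (simp add: n_def DIM_positive Suc_leI)
  \<comment> \<open>A coordinate of at least 1/4 along \<open>b\<close> keeps the norm above 1/4,
    while the other coordinates add up to at most \<open>r / 4\<close>; hence the ratio
    \<open>perp b y / norm y\<close> is at most \<open>r\<close>.\<close>
  define l where "l = (\<Sum>i\<in>Basis. (if i = b then 1/4 else - r / (4 * n)) *\<^sub>R i)"
  define u where "u = (\<Sum>i\<in>Basis. (if i = b then 1/2 else r / (4 * n)) *\<^sub>R i)"
  have u: "u \<bullet> i = (if i = b then 1/2 else r / (4 * n))"
    and l: "l \<bullet> i = (if i = b then 1/4 else - r / (4 * n))" if "i \<in> Basis" for i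
    using that by (simp_all add: u_def l_def)
  have "cbox l u \<subseteq> {y \<in> cball 0 1 - {0}. y /\<^sub>R norm y \<in> {x \<in> sphere 0 1. perp b x \<le> r}}"
  proof (intro subsetI)
    fix y assume "y \<in> cbox l u"
    then have y: "l \<bullet> i \<le> y \<bullet> i" "y \<bullet> i \<le> u \<bullet> i" if "i \<in> Basis" for i
      using that by (auto simp: mem_box)
    have yb: "1/4 \<le> y \<bullet> b" "y \<bullet> b \<le> 1/2" using y[OF assms(1)] assms(1) by (auto simp: u l)
    have "(\<Sum>i\<in>Basis - {b}. \<bar>y \<bullet> i\<bar>) \<le> (\<Sum>i\<in>Basis - {b}. r / (4 * n))"
    proof (rule sum_mono)
      fix i assume "i \<in> Basis - {b}"
      then show "\<bar>y \<bullet> i\<bar> \<le> r / (4 * n)" using y[of i] by (auto simp: u l abs_le_iff)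
    qed
    also have "\<dots> \<le> n * (r / (4 * n))"
    proof -
      have "real (card (Basis - {b})) \<le> n"
        unfolding n_def by (intro of_nat_mono card_mono) auto
      then have "real (card (Basis - {b})) * (r / (4 * n)) \<le> n * (r / (4 * n))"
        using assms n by (intro mult_right_mono) auto
      then show ?thesis by simp
    qed
    also have "\<dots> = r / 4" using n by simp
    finally have perp: "perp b y \<le> r / 4" using perp_le_sum[OF assms(1), of y] by linarith
    have "1/4 \<le> norm y" using yb Basis_le_norm[OF assms(1), of y] by linarith
    moreover have "norm y \<le> 1"
    proof -
      have "norm y \<le> norm (y - (y \<bullet> b) *\<^sub>R b) + norm ((y \<bullet> b) *\<^sub>R b)"
        by (metis norm_triangle_ineq diff_add_cancel)
      also have "\<dots> \<le> r / 4 + 1 / 2" using perp yb assms(1) by (simp add: perp_def)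
      finally show ?thesis using assms by simp
    qed
    moreover have "perp b y \<le> r * norm y"
      using perp mult_left_mono[OF calculation(1) assms(2)] by simp
    moreover have "y \<noteq> 0" using calculation(1) by auto
    moreover have "perp b (y /\<^sub>R norm y) = perp b y / norm y"
      by (simp add: perp_scaleR divide_inverse mult.commute)
    moreover have "perp b y / norm y \<le> r" using calculation(3,4) by (simp add: pos_divide_le_eq)
    ultimately show "y \<in> {y \<in> cball 0 1 - {0}. y /\<^sub>R norm y \<in> {x \<in> sphere 0 1. perp b x \<le> r}}"
      by simp
  qed
  then have "emeasure lborel (cbox l u)
      \<le> emeasure lborel {y \<in> cball 0 1 - {0}. y /\<^sub>R norm y \<in> {x \<in> sphere 0 1. perp b x \<le> r}}"
    using sets_cone[OF perp_le_sets(1), of b r] by (intro emeasure_mono) (simp_all only: sets_lborel)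
  also have "\<dots> \<le> of_nat DIM('a) * \<dots>"
  proof -
    have "(of_nat 1 :: ennreal) \<le> of_nat DIM('a)" by (intro of_nat_mono) (simp add: Suc_leI)
    then show ?thesis using mult_right_mono[of "1 :: ennreal" "of_nat DIM('a)"] by simp
  qed
  also have "\<dots> = emeasure sphere_measure {x \<in> sphere 0 1. perp b x \<le> r}"
    by (rule emeasure_sphere_measure[OF perp_le_sets, symmetric])
  also have "emeasure lborel (cbox l u) = ennreal (\<Prod>i\<in>Basis. (u - l) \<bullet> i)"
    using assms n by (intro emeasure_lborel_cbox) (auto simp: u l intro: order_trans[of _ 0])
  also have "(\<Prod>i\<in>Basis. (u - l) \<bullet> i) = (\<Prod>i\<in>Basis. if i = b then 1/4 else r / (2 * n))"
    by (intro prod.cong) (auto simp: u l inner_diff_left)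
  also have "\<dots> = 1/4 * (r / (2 * n)) ^ (DIM('a) - 1)"
    by (rule prod_Basis_if[OF assms(1)])
  finally show ?thesis by (simp add: n_def)
qed

section \<open>Green's formula on the sphere\<close>

text \<open>A derivative within the sphere is determined on tangent vectors only. Here
  \<open>D\<close> is carried along as data, so its values in the normal direction are a choice, as
  long as they vary continuously.\<close>

definition sphere_C1 ::
    "('a::euclidean_space \<Rightarrow> 'b::real_normed_vector) \<Rightarrow> ('a \<Rightarrow> 'a \<Rightarrow> 'b) \<Rightarrow> bool" where
  "sphere_C1 X D \<longleftrightarrow>
     (\<forall>x\<in>sphere 0 1. (X has_derivative D x) (at x within sphere 0 1)) \<and>
     (\<forall>h. continuous_on (sphere 0 1) (\<lambda>x. D x h))"

lemma sphere_C1_deriv: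
  "sphere_C1 X D \<Longrightarrow> x \<in> sphere 0 1 \<Longrightarrow> (X has_derivative D x) (at x within sphere 0 1)"
  by (simp add: sphere_C1_def)

lemma sphere_C1_cont: "sphere_C1 X D \<Longrightarrow> continuous_on (sphere 0 1) (\<lambda>x. D x h)"
  by (simp add: sphere_C1_def)

lemma sphere_C1_linear: "sphere_C1 X D \<Longrightarrow> x \<in> sphere 0 1 \<Longrightarrow> linear (D x)"
  using sphere_C1_deriv has_derivative_linear by blast

lemma sphere_C1_continuous_on: "sphere_C1 X D \<Longrightarrow> continuous_on (sphere 0 1) X"
  by (meson continuous_on_eq_continuous_within has_derivative_continuous sphere_C1_deriv)

lemma has_vector_derivative_sphere_curve:
  assumes X: "(X has_derivative D) (at (c t) within sphere 0 1)"
    and c: "(c has_vector_derivative v) (at t)" "\<And>t. c t \<in> sphere 0 1"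
  shows "((\<lambda>t. X (c t)) has_vector_derivative D v) (at t)"
proof -
  have "(X has_derivative D) (at (c t) within range c)"
    using X c(2) by (meson has_derivative_subset image_subsetI)
  then have "((\<lambda>t. X (c t)) has_derivative (\<lambda>h. D (h *\<^sub>R v))) (at t)"
    using c(1) has_derivative_in_compose[of c "\<lambda>h. h *\<^sub>R v" t UNIV X D]
    by (simp add: has_vector_derivative_def)
  moreover have "D (h *\<^sub>R v) = h *\<^sub>R D v" for h
    using X has_derivative_linear linear_scale by blast
  ultimately show ?thesis by (simp add: has_vector_derivative_def)
qed

text \<open>Along the great circle through \<open>x\<close> with velocity \<open>h\<close> both
  derivatives become ordinary derivatives in one real variable.\<close>

lemma sphere_deriv_unique_unit:
  fixes X :: "'a::euclidean_space \<Rightarrow> 'b::real_normed_vector"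
  assumes "(X has_derivative D) (at x within sphere 0 1)" "(X has_derivative D') (at x within sphere 0 1)"
    and x: "norm x = 1" and h: "norm h = 1" "h \<bullet> x = 0"
  shows "D h = D' h"
proof -
  define c where "c t = cos t *\<^sub>R x + sin t *\<^sub>R h" for t :: real
  have "(norm (c t))\<^sup>2 = 1" for t
  proof -
    have xx: "x \<bullet> x = 1" and hh: "h \<bullet> h = 1" using x h(1) norm_eq_1 by blast+
    have "(norm (c t))\<^sup>2 = (cos t)\<^sup>2 * (x \<bullet> x) + 2 * cos t * sin t * (h \<bullet> x) + (sin t)\<^sup>2 * (h \<bullet> h)"
      unfolding c_def power2_norm_eq_inner
      by (simp add: inner_add_left inner_add_right inner_commute[of x h] power2_eq_square algebra_simps)
    also have "\<dots> = 1" unfolding xx hh h(2) by simp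
    finally show ?thesis .
  qed
  then have sph: "c t \<in> sphere 0 1" for t using power2_eq_imp_eq[of "norm (c t)" 1] by simp
  have "(c has_vector_derivative ((- sin t) *\<^sub>R x + cos t *\<^sub>R h)) (at t)" for t
    unfolding c_def
    using has_vector_derivative_add[OF has_vector_derivative_scaleR[OF DERIV_cos has_vector_derivative_const[of x]]
        has_vector_derivative_scaleR[OF DERIV_sin has_vector_derivative_const[of h]]]
    by simp
  from this[of 0] have c: "(c has_vector_derivative h) (at 0)" by simp
  have c0: "c 0 = x" by (simp add: c_def)
  have "((\<lambda>t. X (c t)) has_vector_derivative D h) (at 0)"
    by (rule has_vector_derivative_sphere_curve) (use assms(1) c sph in \<open>simp_all only: c0\<close>)
  moreover have "((\<lambda>t. X (c t)) has_vector_derivative D' h) (at 0)"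
    by (rule has_vector_derivative_sphere_curve) (use assms(2) c sph in \<open>simp_all only: c0\<close>)
  ultimately show ?thesis by (rule vector_derivative_unique_at)
qed

lemma sphere_deriv_unique:
  fixes X :: "'a::euclidean_space \<Rightarrow> 'b::real_normed_vector"
  assumes D: "(X has_derivative D) (at x within sphere 0 1)" "(X has_derivative D') (at x within sphere 0 1)"
    and x: "norm x = 1" and h: "h \<bullet> x = 0"
  shows "D h = D' h"
proof (cases "h = 0")
  case True
  then show ?thesis using D has_derivative_linear linear_0 by metis
next
  case False
  then have "D (h /\<^sub>R norm h) = D' (h /\<^sub>R norm h)"
    using h by (intro sphere_deriv_unique_unit[OF D x]) auto
  then have "norm h *\<^sub>R D (h /\<^sub>R norm h) = norm h *\<^sub>R D' (h /\<^sub>R norm h)" by simp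
  then show ?thesis
    using D[THEN has_derivative_linear] False by (simp add: linear_scale)
qed

text \<open>Both vectors are tangent, so their difference is an admissible direction to test
  with.\<close>

lemma has_sphere_grad_unique:
  assumes "has_sphere_grad f v x" "has_sphere_grad f w x" "norm x = 1"
  shows "v = w"
proof -
  have "(v - w) \<bullet> x = 0" using assms by (simp add: has_sphere_grad_def inner_diff_left)
  then have "v \<bullet> (v - w) = w \<bullet> (v - w)"
    using assms sphere_deriv_unique[of f "\<lambda>h. v \<bullet> h" x "\<lambda>h. w \<bullet> h"] by (simp add: has_sphere_grad_def)
  then have "(v - w) \<bullet> (v - w) = 0" by (simp add: inner_diff_left)
  then show ?thesis by simp
qed

text \<open>On the unit sphere \<open>y \<bullet> x - 1 = - \<bar>y - x\<bar>\<^sup>2 / 2\<close>, so a derivative within the sphere may be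
  altered freely in the normal direction.\<close>

lemma has_derivative_sphere_tangential:
  fixes X :: "'a::euclidean_space \<Rightarrow> 'b::real_normed_vector"
  assumes X: "(X has_derivative D) (at x within sphere 0 1)" and x: "norm x = 1"
  shows "(X has_derivative (\<lambda>h. D h - (h \<bullet> x) *\<^sub>R D x)) (at x within sphere 0 1)"
proof -
  have A: "((\<lambda>y. (1 - ((y - x) \<bullet> (y - x)) / 2) *\<^sub>R D x) has_derivative (\<lambda>h. 0)) (at x within sphere 0 1)"
    by (auto intro!: derivative_eq_intros)
  have B: "(1 - ((y - x) \<bullet> (y - x)) / 2) *\<^sub>R D x = (y \<bullet> x) *\<^sub>R D x" if "y \<in> sphere 0 1" for y
  proof -
    have yy: "y \<bullet> y = 1" and xx: "x \<bullet> x = 1" using that x norm_eq_1 by auto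
    have "1 - ((y - x) \<bullet> (y - x)) / 2 = y \<bullet> x"
      unfolding inner_diff_left inner_diff_right inner_commute[of x y] yy xx by (simp add: field_simps)
    then show ?thesis by simp
  qed
  have 1: "((\<lambda>y. (y \<bullet> x) *\<^sub>R D x) has_derivative (\<lambda>h. 0)) (at x within sphere 0 1)"
    by (rule has_derivative_transform[OF _ B[symmetric] A]) (use x in simp_all)
  have 2: "((\<lambda>y. (y \<bullet> x) *\<^sub>R D x) has_derivative (\<lambda>h. (h \<bullet> x) *\<^sub>R D x)) (at x within sphere 0 1)"
    by (auto intro!: derivative_eq_intros)
  show ?thesis
    using has_derivative_add[OF has_derivative_diff[OF X 2] 1] by simp
qed

text \<open>For a unit vector \<open>x\<close> this is the trace of the compression of a linear
  \<open>L\<close> to the tangent space at \<open>x\<close>; unlike the full trace it does not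
  depend on \<open>L x\<close>.\<close>

definition tangential_trace :: "'a::euclidean_space \<Rightarrow> ('a \<Rightarrow> 'a) \<Rightarrow> real" where
  "tangential_trace x L = (\<Sum>b\<in>Basis. L b \<bullet> b) - L x \<bullet> x"

text \<open>Removing the normal part of \<open>D\<close> gives a derivative that vanishes at
  \<open>x\<close>. It is the only such one, by uniqueness on tangent vectors, and its full trace is
  the tangential trace of \<open>D\<close>.\<close>

lemma sphere_div_eq:
  assumes X: "(X has_derivative D) (at x within sphere 0 1)" and x: "norm x = 1"
  shows "sphere_div X x = tangential_trace x D"
proof -
  have xx: "x \<bullet> x = 1" using x norm_eq_1 by blast
  have trace: "(\<Sum>b\<in>Basis. (D b - (b \<bullet> x) *\<^sub>R D x) \<bullet> b) = tangential_trace x D"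
  proof -
    have "(\<Sum>b\<in>Basis. (b \<bullet> x) * (D x \<bullet> b)) = D x \<bullet> x"
      by (subst euclidean_inner[of "D x" x]) (simp add: inner_commute mult.commute)
    then show ?thesis by (simp add: tangential_trace_def inner_diff_left sum_subtractf)
  qed
  show ?thesis
    unfolding sphere_div_def
  proof (rule the_equality)
    show "\<exists>D'. (X has_derivative D') (at x within sphere 0 1) \<and> D' x = 0 \<and>
        tangential_trace x D = (\<Sum>b\<in>Basis. D' b \<bullet> b)"
    proof (intro exI conjI)
      show "(X has_derivative (\<lambda>h. D h - (h \<bullet> x) *\<^sub>R D x)) (at x within sphere 0 1)"
        by (rule has_derivative_sphere_tangential[OF assms])
      show "D x - (x \<bullet> x) *\<^sub>R D x = 0" unfolding xx by simp
    qed (rule trace[symmetric])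
  next
    fix s assume "\<exists>D'. (X has_derivative D') (at x within sphere 0 1) \<and> D' x = 0 \<and>
        s = (\<Sum>b\<in>Basis. D' b \<bullet> b)"
    then obtain D' where D': "(X has_derivative D') (at x within sphere 0 1)" "D' x = 0"
        "s = (\<Sum>b\<in>Basis. D' b \<bullet> b)" by blast
    have "D' b = D b - (b \<bullet> x) *\<^sub>R D x" for b
    proof -
      have "(b - (b \<bullet> x) *\<^sub>R x) \<bullet> x = 0" unfolding inner_diff_left inner_scaleR_left xx by simp
      from sphere_deriv_unique[OF D'(1) X x this] show ?thesis
        using D'(1,2) X[THEN has_derivative_linear] has_derivative_linear[OF D'(1)]
        by (simp add: linear_diff linear_scale)
    qed
    then show "s = tangential_trace x D" using D'(3) trace by simp
  qed
qed

text \<open>Eliminates the definite descriptions in \<open>sphere_grad\<close> and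
  \<open>sphere_div\<close> in favour of explicit fields to which Green's formula applies.\<close>

lemma C2_sphereE:
  assumes "C2_sphere (u :: 'a::euclidean_space \<Rightarrow> real)"
  obtains v D where "sphere_C1 u (\<lambda>x h. v x \<bullet> h)" "sphere_C1 v D" "\<And>x. x \<in> sphere 0 1 \<Longrightarrow> v x \<bullet> x = 0"
    "\<And>x. x \<in> sphere 0 1 \<Longrightarrow> tangential_trace x (D x) = - sphere_laplacian u x"
proof -
  note C2 = assms[unfolded C2_sphere_def]
  from C2[THEN conjunct2] obtain D :: "'a \<Rightarrow> 'a \<Rightarrow>\<^sub>L 'a" where D_cont: "continuous_on (sphere 0 1) D"
    and "\<forall>x\<in>sphere 0 1. (sphere_grad u has_derivative blinfun_apply (D x)) (at x within sphere 0 1)"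
    by (elim exE conjE)
  then have D: "(sphere_grad u has_derivative blinfun_apply (D x)) (at x within sphere 0 1)"
    if "x \<in> sphere 0 1" for x
    using that by (elim bspec)
  have grad: "has_sphere_grad u (sphere_grad u x) x" if "x \<in> sphere 0 1" for x
  proof -
    from bspec[OF C2[THEN conjunct1] that] obtain v where v: "has_sphere_grad u v x" by (elim exE)
    have x: "norm x = 1" using that by simp
    have "sphere_grad u x = v"
      unfolding sphere_grad_def
      by (rule the_equality[where P = "\<lambda>v. has_sphere_grad u v x", OF v])
        (rule has_sphere_grad_unique[OF _ v x])
    then show ?thesis using v by simp
  qed
  have C1: "sphere_C1 (sphere_grad u) (\<lambda>x. blinfun_apply (D x))"
    unfolding sphere_C1_def using D D_cont by (auto intro!: continuous_intros)
  show thesis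
  proof (rule that[of "sphere_grad u" "\<lambda>x. blinfun_apply (D x)"])
    show "sphere_C1 u (\<lambda>x h. sphere_grad u x \<bullet> h)"
      using grad sphere_C1_continuous_on[OF C1]
      by (auto simp: sphere_C1_def has_sphere_grad_def intro!: continuous_intros)
    show "sphere_C1 (sphere_grad u) (\<lambda>x. blinfun_apply (D x))" by (rule C1)
    fix x :: 'a assume x: "x \<in> sphere 0 1"
    show "sphere_grad u x \<bullet> x = 0" using grad[OF x] by (simp add: has_sphere_grad_def)
    show "tangential_trace x (blinfun_apply (D x)) = - sphere_laplacian u x"
      using sphere_div_eq[OF D[OF x]] x by (simp add: sphere_laplacian_def)
  qed
qed


section \<open>Rotations in coordinate planes and the divergence theorem\<close>

definition rot :: "'a::euclidean_space \<Rightarrow> 'a \<Rightarrow> real \<Rightarrow> 'a \<Rightarrow> 'a" where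
  "rot i j t x = x + (((cos t - 1) * (x \<bullet> i) - sin t * (x \<bullet> j)) *\<^sub>R i
     + (sin t * (x \<bullet> i) + (cos t - 1) * (x \<bullet> j)) *\<^sub>R j)"

text \<open>The Killing field of the flow \<open>rot i j\<close>. It is zero for
  \<open>i = j\<close>, so sums may run over all pairs.\<close>

definition rot_gen :: "'a::euclidean_space \<Rightarrow> 'a \<Rightarrow> 'a \<Rightarrow> 'a" where
  "rot_gen i j x = (x \<bullet> i) *\<^sub>R j - (x \<bullet> j) *\<^sub>R i"

lemma orthogonal_transformation_rot:
  assumes "i \<in> Basis" "j \<in> Basis" "i \<noteq> j"
  shows "orthogonal_transformation (rot i j t)"
  unfolding orthogonal_transformation
proof (intro conjI allI)
  show "linear (rot i j t)"
    by (rule linearI) (simp_all add: rot_def inner_add_left algebra_simps)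
  fix x
  define a c p q where "a = x \<bullet> i" and "c = x \<bullet> j"
    and "p = (cos t - 1) * (x \<bullet> i) - sin t * (x \<bullet> j)"
    and "q = sin t * (x \<bullet> i) + (cos t - 1) * (x \<bullet> j)"
  have ij: "i \<bullet> i = 1" "j \<bullet> j = 1" "i \<bullet> j = 0" "j \<bullet> i = 0"
    using assms inner_not_same_Basis by (auto simp: inner_same_Basis)
  have rot: "rot i j t x = x + (p *\<^sub>R i + q *\<^sub>R j)" by (simp add: rot_def p_def q_def)
  have "rot i j t x \<bullet> rot i j t x = x \<bullet> x + 2 * (p * a + q * c) + (p * p + q * q)"
    unfolding rot inner_add_left inner_add_right inner_scaleR_left inner_scaleR_right ij a_def c_def
      inner_commute[of i x] inner_commute[of j x] by (simp add: algebra_simps)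
  also have "p * p + q * q = - 2 * (p * a + q * c)"
    unfolding p_def q_def a_def[symmetric] c_def[symmetric] using sin_cos_squared_add[of t] by algebra
  finally show "norm (rot i j t x) = norm x" by (simp add: norm_eq_sqrt_inner)
qed

lemma has_vector_derivative_rot:
  assumes "i \<in> Basis" "j \<in> Basis" "i \<noteq> j"
  shows "((\<lambda>t. rot i j t x) has_vector_derivative rot_gen i j (rot i j t x)) (at t)"
proof -
  have ij: "i \<bullet> i = 1" "j \<bullet> j = 1" "i \<bullet> j = 0" "j \<bullet> i = 0"
    using assms inner_not_same_Basis by (auto simp: inner_same_Basis)
  have "((\<lambda>t. rot i j t x) has_vector_derivative
     (0 + (((- sin t) * (x \<bullet> i) - cos t * (x \<bullet> j)) *\<^sub>R i
     + (cos t * (x \<bullet> i) + (- sin t) * (x \<bullet> j)) *\<^sub>R j))) (at t)"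
    unfolding rot_def
    by (intro has_vector_derivative_add has_vector_derivative_const
      has_vector_derivative_scaleR[where g="\<lambda>_. i" and g'=0, simplified]
      has_vector_derivative_scaleR[where g="\<lambda>_. j" and g'=0, simplified])
     (auto intro!: derivative_eq_intros)
  also have "0 + (((- sin t) * (x \<bullet> i) - cos t * (x \<bullet> j)) *\<^sub>R i
     + (cos t * (x \<bullet> i) + (- sin t) * (x \<bullet> j)) *\<^sub>R j) = rot_gen i j (rot i j t x)"
    unfolding rot_def rot_gen_def inner_add_left inner_scaleR_left ij
    by (simp add: algebra_simps)
  finally show ?thesis .
qed

lemma rot_0: "rot i j 0 x = x"
  by (simp add: rot_def)

lemma rot_sphere:
  "i \<in> Basis \<Longrightarrow> j \<in> Basis \<Longrightarrow> i \<noteq> j \<Longrightarrow> x \<in> sphere 0 1 \<Longrightarrow> rot i j t x \<in> sphere 0 1"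
  by (simp add: orthogonal_transformation_norm[OF orthogonal_transformation_rot])

text \<open>The integral of \<open>h\<close> composed with a rotation does not depend on the angle;
  its derivative at angle 0 is taken under the integral.\<close>

lemma integral_rot_gen_derivative_eq_0:
  fixes h :: "'a::euclidean_space \<Rightarrow> real"
  assumes ij: "i \<in> Basis" "j \<in> Basis" and h: "sphere_C1 h D"
  shows "continuous_on (sphere 0 1) (\<lambda>x. D x (rot_gen i j x))"
    "(LINT x|sphere_measure. D x (rot_gen i j x)) = 0"
proof -
  define g where "g x = D x (rot_gen i j x)" for x
  have g_eq: "g x = (x \<bullet> i) * D x j - (x \<bullet> j) * D x i" if "x \<in> sphere 0 1" for x
    using sphere_C1_linear[OF h that] by (simp add: g_def rot_gen_def linear_diff linear_scale)
  have cont: "continuous_on (sphere 0 1) g"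
  proof (rule continuous_on_eq)
    show "continuous_on (sphere 0 1) (\<lambda>x. (x \<bullet> i) * D x j - (x \<bullet> j) * D x i)"
      by (intro continuous_intros sphere_C1_cont[OF h])
  qed (simp only: g_eq)
  then show "continuous_on (sphere 0 1) (\<lambda>x. D x (rot_gen i j x))" by (simp add: g_def[abs_def])
  have "(LINT x|sphere_measure. g x) = 0"
  \<comment> \<open>For \<open>i = j\<close> the map \<open>rot i j t\<close> is not a rotation, but
    then the field vanishes.\<close>
  proof (cases "i = j")
    case True
    then have "(LINT x|sphere_measure. g x) = (LINT x|(sphere_measure :: 'a measure). 0)"
      using g_eq by (intro Bochner_Integration.integral_cong) auto
    then show ?thesis by simp
  next
    case False
    note rot_ij = ij False
    interpret finite_measure "sphere_measure :: 'a measure" by (rule finite_measure_sphere)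
    have h_cont: "continuous_on (sphere 0 1) h" by (rule sphere_C1_continuous_on[OF h])
    have h_meas: "h \<in> borel_measurable sphere_measure" by (rule borel_measurable_sphere[OF h_cont])
    have orth: "orthogonal_transformation (rot i j t)" for t
      by (rule orthogonal_transformation_rot[OF rot_ij])
    have hr_meas: "(\<lambda>x. h (rot i j t x)) \<in> borel_measurable sphere_measure" for t
      by (rule measurable_compose[OF distr_sphere_measure_orthogonal(1)[OF orth] h_meas])
    have hr_cont: "continuous_on (sphere 0 1) (\<lambda>x. h (rot i j t x))" for t
    proof (rule continuous_on_compose2[OF h_cont])
      show "continuous_on (sphere 0 1) (rot i j t)"
        using orth[of t] by (intro linear_continuous_on)
          (simp add: orthogonal_transformation_def linear_conv_bounded_linear)
    qed (use rot_sphere[OF rot_ij] in blast)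
    have deriv: "((\<lambda>t. h (rot i j t x)) has_real_derivative g (rot i j t x)) (at t)"
      if x: "x \<in> sphere 0 1" for x t
      unfolding has_real_derivative_iff_has_vector_derivative g_def
      by (rule has_vector_derivative_sphere_curve[OF sphere_C1_deriv[OF h] has_vector_derivative_rot[OF rot_ij]])
        (use rot_sphere[OF rot_ij x] in blast)+
    have "compact (g ` sphere 0 1)" using cont by (intro compact_continuous_image) auto
    then obtain C where C: "\<And>x. x \<in> sphere 0 1 \<Longrightarrow> norm (g x) \<le> C"
      using compact_imp_bounded bounded_iff by (metis imageI)
    \<comment> \<open>Difference quotients of the flow. Each has integral zero by invariance, and
      the mean value theorem bounds them all by a bound of \<open>\<bar>g\<bar>\<close> on the
      sphere.\<close>
    define s where "s n x = (h (rot i j (inverse (Suc n)) x) - h x) / inverse (Suc n)" for n x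
    have "(\<lambda>n. LINT x|sphere_measure. s n x) \<longlonglongrightarrow> (LINT x|sphere_measure. g x)"
    proof (rule integral_dominated_convergence[where w="\<lambda>_. C"])
      show "g \<in> borel_measurable sphere_measure" by (rule borel_measurable_sphere[OF cont])
      show "s n \<in> borel_measurable sphere_measure" for n
        unfolding s_def by (intro borel_measurable_divide borel_measurable_diff hr_meas h_meas borel_measurable_const)
      show "AE x in sphere_measure. (\<lambda>n. s n x) \<longlonglongrightarrow> g x"
      proof (rule AE_I2)
        fix x :: 'a assume "x \<in> space sphere_measure"
        then have x: "x \<in> sphere 0 1" by simp
        have "(\<lambda>t. (h (rot i j (0 + t) x) - h (rot i j 0 x)) / t) \<midarrow>0\<rightarrow> g (rot i j 0 x)"
          using deriv[OF x, of 0] unfolding DERIV_def .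
        then have "(\<lambda>t. (h (rot i j t x) - h x) / t) \<midarrow>0\<rightarrow> g x" by (simp add: rot_0)
        moreover have "filterlim (\<lambda>n. inverse (real (Suc n))) (at 0) sequentially"
          using LIMSEQ_inverse_real_of_nat by (simp add: filterlim_at)
        ultimately show "(\<lambda>n. s n x) \<longlonglongrightarrow> g x"
          unfolding s_def by (rule filterlim_compose)
      qed
      show "AE x in sphere_measure. norm (s n x) \<le> C" for n
      proof (rule AE_I2)
        fix x :: 'a assume "x \<in> space sphere_measure"
        then have x: "x \<in> sphere 0 1" by simp
        define t where "t = inverse (real (Suc n))"
        have t: "t > 0" by (simp add: t_def)
        have "norm (h (rot i j t x) - h (rot i j 0 x)) \<le> C * norm (t - 0)"
          by (rule field_differentiable_bound[where S = UNIV and f' = "\<lambda>t. g (rot i j t x)"])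
            (use deriv[OF x] C[OF rot_sphere[OF rot_ij x]] in simp_all)
        then have "\<bar>h (rot i j t x) - h x\<bar> / t \<le> C" using t by (simp add: rot_0 pos_divide_le_eq)
        then show "norm (s n x) \<le> C" using t by (simp add: s_def t_def)
      qed
    qed simp
    moreover have "(LINT x|sphere_measure. s n x) = 0" for n
    proof -
      have "(LINT x|sphere_measure. s n x)
          = ((LINT x|sphere_measure. h (rot i j (inverse (Suc n)) x)) - (LINT x|sphere_measure. h x)) / inverse (Suc n)"
        unfolding s_def by (simp add: integrable_sphere[OF hr_cont] integrable_sphere[OF h_cont])
      then show ?thesis using integral_sphere_orthogonal[OF orth h_meas] by simp
    qed
    ultimately show ?thesis by (simp add: LIMSEQ_const_iff)
  qed
  then show "(LINT x|sphere_measure. D x (rot_gen i j x)) = 0" by (simp add: g_def)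
qed

text \<open>The sum of the tensor squares of the rotation fields at a unit vector \<open>x\<close>
  is twice the orthogonal projection onto the tangent space; the 2 arises because each plane is
  counted in both orders.\<close>

lemma sum_rot_gen_trace:
  assumes "linear L" "norm x = 1"
  shows "(\<Sum>i\<in>Basis. \<Sum>j\<in>Basis. L (rot_gen i j x) \<bullet> rot_gen i j x) = 2 * tangential_trace x L"
proof -
  have xx: "x \<bullet> x = 1" using assms(2) norm_eq_1 by blast
  have 1: "L (rot_gen i j x) \<bullet> rot_gen i j x = (x \<bullet> i) * (x \<bullet> i) * (L j \<bullet> j) + (L i \<bullet> i) * ((x \<bullet> j) * (x \<bullet> j))
      - (x \<bullet> j) * ((x \<bullet> i) * (L j \<bullet> i)) - (x \<bullet> i) * ((x \<bullet> j) * (L i \<bullet> j))" for i j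
    using assms(1) by (simp add: rot_gen_def linear_diff linear_scale inner_diff_left inner_diff_right algebra_simps)
  have 2: "(\<Sum>i\<in>Basis. (x \<bullet> i) * (x \<bullet> i)) = 1" using euclidean_inner[of x x] xx by simp
  have 3: "(\<Sum>i\<in>Basis. (x \<bullet> i) * (v \<bullet> i)) = v \<bullet> x" for v
    by (simp add: euclidean_inner[of v x] mult.commute)
  have "L (\<Sum>j\<in>Basis. (x \<bullet> j) *\<^sub>R j) \<bullet> x = (\<Sum>j\<in>Basis. (x \<bullet> j) * (L j \<bullet> x))"
    using assms(1) by (simp add: linear_sum linear_scale inner_sum_left)
  then have 4: "(\<Sum>j\<in>Basis. (x \<bullet> j) * (L j \<bullet> x)) = L x \<bullet> x"
    unfolding euclidean_representation by (rule sym)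
  have a: "(\<Sum>i\<in>Basis. \<Sum>j\<in>Basis. (x \<bullet> i) * (x \<bullet> i) * (L j \<bullet> j)) = (\<Sum>b\<in>Basis. L b \<bullet> b)"
    unfolding sum_product[symmetric] 2 by simp
  have b: "(\<Sum>i\<in>Basis. \<Sum>j\<in>Basis. (L i \<bullet> i) * ((x \<bullet> j) * (x \<bullet> j))) = (\<Sum>b\<in>Basis. L b \<bullet> b)"
    unfolding sum_product[symmetric] 2 by simp
  have d: "(\<Sum>i\<in>Basis. \<Sum>j\<in>Basis. (x \<bullet> i) * ((x \<bullet> j) * (L i \<bullet> j))) = L x \<bullet> x"
    unfolding sum_distrib_left[symmetric] 3 4 ..
  have c: "(\<Sum>i\<in>Basis. \<Sum>j\<in>Basis. (x \<bullet> j) * ((x \<bullet> i) * (L j \<bullet> i))) = L x \<bullet> x"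
    by (subst sum.swap) (rule d)
  show ?thesis
    unfolding 1 sum.distrib sum_subtractf a b c d tangential_trace_def by simp
qed

text \<open>For \<open>i \<noteq> j\<close>, applying the generator twice gives minus the projection
  onto the plane. The sum over all pairs is therefore a multiple of \<open>x\<close>, to which
  \<open>v\<close> is orthogonal.\<close>

lemma sum_rot_gen_rot_gen:
  fixes x v :: "'a::euclidean_space"
  assumes "v \<bullet> x = 0"
  shows "(\<Sum>i\<in>Basis. \<Sum>j\<in>Basis. v \<bullet> rot_gen i j (rot_gen i j x)) = 0"
proof -
  have 1: "v \<bullet> rot_gen i j (rot_gen i j x)
      = (if i = j then 2 * ((x \<bullet> i) * (v \<bullet> j)) else 0) - (x \<bullet> j) * (v \<bullet> j) - (x \<bullet> i) * (v \<bullet> i)"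
    if "i \<in> Basis" "j \<in> Basis" for i j :: 'a
    using that by (auto simp: rot_gen_def inner_diff_left inner_diff_right inner_Basis)
  have 3: "(\<Sum>i\<in>Basis. (x \<bullet> i) * (v \<bullet> i)) = 0"
    using assms by (simp add: euclidean_inner[of v x] mult.commute)
  have "(\<Sum>i\<in>Basis. \<Sum>j\<in>Basis. v \<bullet> rot_gen i j (rot_gen i j x))
      = (\<Sum>i\<in>Basis. \<Sum>j\<in>Basis. (if i = j then 2 * ((x \<bullet> i) * (v \<bullet> j)) else 0) - (x \<bullet> j) * (v \<bullet> j) - (x \<bullet> i) * (v \<bullet> i))"
    by (intro sum.cong refl 1)
  also have "\<dots> = 0"
    unfolding sum_subtractf 3 by (simp add: sum_distrib_left[symmetric] 3)
  finally show ?thesis .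
qed

text \<open>The divergence is half the sum over \<open>i\<close>, \<open>j\<close> of the derivatives of \<open>X \<bullet> R\<^sub>i\<^sub>j\<close> along the rotation
  fields \<open>R\<^sub>i\<^sub>j\<close>, and each of these integrates to zero by rotation invariance.\<close>

lemma sphere_divergence_theorem:
  fixes X :: "'a::euclidean_space \<Rightarrow> 'a"
  assumes X: "sphere_C1 X D" and tangent: "\<And>x. x \<in> sphere 0 1 \<Longrightarrow> X x \<bullet> x = 0"
  shows "(LINT x|sphere_measure. tangential_trace x (D x)) = 0"
proof -
  define g where "g i j x = D x (rot_gen i j x) \<bullet> rot_gen i j x + X x \<bullet> rot_gen i j (rot_gen i j x)" for i j x
  have gen_cont: "continuous_on A (rot_gen i j)" for A and i j :: 'a
    unfolding rot_gen_def by (intro continuous_intros)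
  have g: "continuous_on (sphere 0 1) (g i j)" "(LINT x|sphere_measure. g i j x) = 0"
    if ij: "i \<in> Basis" "j \<in> Basis" for i j
  proof -
    have "sphere_C1 (\<lambda>x. X x \<bullet> rot_gen i j x) (\<lambda>x h. D x h \<bullet> rot_gen i j x + X x \<bullet> rot_gen i j h)"
      unfolding sphere_C1_def
    proof (intro conjI ballI allI)
      fix x :: 'a assume x: "x \<in> sphere 0 1"
      have "(rot_gen i j has_derivative rot_gen i j) (at x within sphere 0 1)"
        unfolding rot_gen_def by (auto intro!: derivative_eq_intros)
      from has_derivative_inner[OF sphere_C1_deriv[OF X x] this]
      show "((\<lambda>x. X x \<bullet> rot_gen i j x) has_derivative (\<lambda>h. D x h \<bullet> rot_gen i j x + X x \<bullet> rot_gen i j h))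
          (at x within sphere 0 1)"
        by (simp add: add.commute)
    qed (intro continuous_intros sphere_C1_cont[OF X] sphere_C1_continuous_on[OF X] gen_cont)
    from integral_rot_gen_derivative_eq_0[OF ij this]
    show "continuous_on (sphere 0 1) (g i j)" "(LINT x|sphere_measure. g i j x) = 0"
      by (simp_all add: g_def[abs_def])
  qed
  have "2 * tangential_trace x (D x) = (\<Sum>i\<in>Basis. \<Sum>j\<in>Basis. g i j x)" if "x \<in> sphere 0 1" for x
    using sum_rot_gen_trace[OF sphere_C1_linear[OF X that]] sum_rot_gen_rot_gen[OF tangent[OF that]] that
    by (simp add: g_def sum.distrib)
  then have "(LINT x|sphere_measure. 2 * tangential_trace x (D x))
      = (LINT x|sphere_measure. (\<Sum>i\<in>Basis. \<Sum>j\<in>Basis. g i j x))"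
    by (intro Bochner_Integration.integral_cong) auto
  also have "\<dots> = (\<Sum>i\<in>Basis. \<Sum>j\<in>Basis. (LINT x|sphere_measure. g i j x))"
    using g(1) by (simp add: integrable_sphere)
  also have "\<dots> = 0" using g(2) by simp
  finally show ?thesis by simp
qed

text \<open>The divergence theorem for the tangent field \<open>w x *\<^sub>R v x\<close>, where
  \<open>v\<close> is the gradient of \<open>u\<close>.\<close>

lemma sphere_Green:
  fixes u w :: "'a::euclidean_space \<Rightarrow> real"
  assumes u: "sphere_C1 u (\<lambda>x h. v x \<bullet> h)" "sphere_C1 v D" "\<And>x. x \<in> sphere 0 1 \<Longrightarrow> v x \<bullet> x = 0"
    and w: "sphere_C1 w (\<lambda>x h. z x \<bullet> h)" "continuous_on (sphere 0 1) z"
  shows "(LINT x|sphere_measure. w x * tangential_trace x (D x)) = - (LINT x|sphere_measure. z x \<bullet> v x)"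
proof -
  have cont_u: "continuous_on (sphere 0 1) v" by (rule sphere_C1_continuous_on[OF u(2)])
  have cont_w: "continuous_on (sphere 0 1) w" by (rule sphere_C1_continuous_on[OF w(1)])
  have C1: "sphere_C1 (\<lambda>x. w x *\<^sub>R v x) (\<lambda>x h. (z x \<bullet> h) *\<^sub>R v x + w x *\<^sub>R D x h)"
    unfolding sphere_C1_def
  proof (intro conjI ballI allI)
    fix x :: 'a assume x: "x \<in> sphere 0 1"
    show "((\<lambda>x. w x *\<^sub>R v x) has_derivative (\<lambda>h. (z x \<bullet> h) *\<^sub>R v x + w x *\<^sub>R D x h)) (at x within sphere 0 1)"
      using has_derivative_scaleR[OF sphere_C1_deriv[OF w(1) x] sphere_C1_deriv[OF u(2) x]]
      by (simp add: add.commute)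
  qed (intro continuous_intros cont_u cont_w w(2) sphere_C1_cont[OF u(2)])
  have "tangential_trace x (\<lambda>h. (z x \<bullet> h) *\<^sub>R v x + w x *\<^sub>R D x h)
      = z x \<bullet> v x + w x * tangential_trace x (D x)" if x: "x \<in> sphere 0 1" for x
    using u(3)[OF x] unfolding tangential_trace_def euclidean_inner[of "z x" "v x"]
    by (simp add: inner_add_left sum.distrib sum_distrib_left algebra_simps)
  then have "(LINT x|sphere_measure. tangential_trace x (\<lambda>h. (z x \<bullet> h) *\<^sub>R v x + w x *\<^sub>R D x h))
      = (LINT x|sphere_measure. z x \<bullet> v x + w x * tangential_trace x (D x))"
    by (intro Bochner_Integration.integral_cong) auto
  also have "\<dots> = (LINT x|sphere_measure. z x \<bullet> v x) + (LINT x|sphere_measure. w x * tangential_trace x (D x))"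
  proof (rule Bochner_Integration.integral_add)
    \<comment> \<open>\<open>sphere_C1\<close> gives continuity only for a fixed direction, so the
      varying direction \<open>x\<close> is expanded in the basis.\<close>
    have "continuous_on (sphere 0 1) (\<lambda>x. D x x)"
    proof -
      have A: "continuous_on (sphere 0 1) (\<lambda>x. \<Sum>b\<in>Basis. (x \<bullet> b) *\<^sub>R D x b)"
        by (intro continuous_intros sphere_C1_cont[OF u(2)])
      have B: "D x x = (\<Sum>b\<in>Basis. (x \<bullet> b) *\<^sub>R D x b)" if "x \<in> sphere 0 1" for x
        using linear_sum[OF sphere_C1_linear[OF u(2) that], of "\<lambda>b. (x \<bullet> b) *\<^sub>R b" Basis]
          linear_scale[OF sphere_C1_linear[OF u(2) that]]
        by (simp add: euclidean_representation)
      show ?thesis by (rule continuous_on_eq[OF A B[symmetric]])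
    qed
    then show "integrable sphere_measure (\<lambda>x. w x * tangential_trace x (D x))"
      unfolding tangential_trace_def
      by (intro integrable_sphere continuous_intros cont_w sphere_C1_cont[OF u(2)])
    show "integrable sphere_measure (\<lambda>x. z x \<bullet> v x)"
      by (intro integrable_sphere continuous_intros w(2) cont_u)
  qed
  finally show ?thesis
    using sphere_divergence_theorem[OF C1] u(3) by simp
qed

text \<open>The Dirichlet form is symmetric, and it equals both \<open>\<kappa>1\<close> and
  \<open>\<kappa>2\<close> times the integral of the product.\<close>

lemma sphere_eigenfunctions_orthogonal:
  fixes u w :: "'a::euclidean_space \<Rightarrow> real"
  assumes u: "sphere_C1 u (\<lambda>x h. v x \<bullet> h)" "sphere_C1 v D" "\<And>x. x \<in> sphere 0 1 \<Longrightarrow> v x \<bullet> x = 0"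
      "\<And>x. x \<in> sphere 0 1 \<Longrightarrow> tangential_trace x (D x) = - \<kappa>1 * u x"
    and w: "sphere_C1 w (\<lambda>x h. z x \<bullet> h)" "sphere_C1 z F" "\<And>x. x \<in> sphere 0 1 \<Longrightarrow> z x \<bullet> x = 0"
      "\<And>x. x \<in> sphere 0 1 \<Longrightarrow> tangential_trace x (F x) = - \<kappa>2 * w x"
    and neq: "\<kappa>1 \<noteq> \<kappa>2"
  shows "(LINT x|sphere_measure. u x * w x) = 0"
proof -
  have "(LINT x|sphere_measure. - \<kappa>1 * (u x * w x)) = (LINT x|sphere_measure. w x * tangential_trace x (D x))"
    using u(4) by (intro Bochner_Integration.integral_cong) auto
  also have "\<dots> = - (LINT x|sphere_measure. z x \<bullet> v x)"
    by (rule sphere_Green[OF u(1-3) w(1) sphere_C1_continuous_on[OF w(2)]])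
  also have "\<dots> = (LINT x|sphere_measure. u x * tangential_trace x (F x))"
    using sphere_Green[OF w(1-3) u(1) sphere_C1_continuous_on[OF u(2)]] by (simp add: inner_commute)
  also have "\<dots> = (LINT x|sphere_measure. - \<kappa>2 * (u x * w x))"
    using w(4) by (intro Bochner_Integration.integral_cong) auto
  finally show ?thesis using neq by simp
qed

section \<open>Zonal eigenfunctions\<close>

text \<open>The gradient of the height \<open>x \<bullet> b\<close> is the tangential part of
  \<open>b\<close>, and \<open>D\<close> is the ambient derivative of \<open>v\<close>. The
  resulting trace is the Gegenbauer operator applied to \<open>\<zeta>\<close>.\<close>

lemma zonal_sphere_C1:
  fixes b :: "'a::euclidean_space"
  assumes b: "b \<in> Basis"
    and \<zeta>: "\<And>t. (\<zeta> has_real_derivative \<zeta>1 t) (at t)" "\<And>t. (\<zeta>1 has_real_derivative \<zeta>2 t) (at t)"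
    and cont: "continuous_on UNIV \<zeta>2"
  defines "v \<equiv> \<lambda>x. \<zeta>1 (x \<bullet> b) *\<^sub>R (b - (x \<bullet> b) *\<^sub>R x)"
    and "D \<equiv> \<lambda>x h. (\<zeta>2 (x \<bullet> b) * (h \<bullet> b)) *\<^sub>R (b - (x \<bullet> b) *\<^sub>R x)
      - \<zeta>1 (x \<bullet> b) *\<^sub>R ((h \<bullet> b) *\<^sub>R x + (x \<bullet> b) *\<^sub>R h)"
  shows "sphere_C1 (\<lambda>x. \<zeta> (x \<bullet> b)) (\<lambda>x h. v x \<bullet> h)" "sphere_C1 v D"
    "\<And>x. x \<in> sphere 0 1 \<Longrightarrow> v x \<bullet> x = 0"
    "\<And>x. x \<in> sphere 0 1 \<Longrightarrow> tangential_trace x (D x)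
       = (1 - (x \<bullet> b)\<^sup>2) * \<zeta>2 (x \<bullet> b) - (real DIM('a) - 1) * (x \<bullet> b) * \<zeta>1 (x \<bullet> b)"
proof -
  have c1: "continuous_on UNIV \<zeta>1"
    using \<zeta>(2) by (meson DERIV_isCont continuous_at_imp_continuous_on)
  have comp: "continuous_on A (\<lambda>x. f (x \<bullet> b))" if "continuous_on UNIV f" for f :: "real \<Rightarrow> real" and A
    by (rule continuous_on_compose2[OF that]) (auto intro!: continuous_intros)
  have inner_b: "((\<lambda>x. x \<bullet> b) has_derivative (\<lambda>h. h \<bullet> b)) (at x within S)" for x S
    by (auto intro!: derivative_eq_intros)
  have chain: "((\<lambda>x. f (x \<bullet> b)) has_derivative (\<lambda>h. f' * (h \<bullet> b))) (at x within S)"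
    if "(f has_real_derivative f') (at (x \<bullet> b))" for f f' x S
    using has_derivative_compose[OF inner_b that[unfolded has_field_derivative_def]] by simp
  have v_cont: "continuous_on A v" for A
    unfolding v_def by (intro continuous_intros comp c1)
  show tangent: "v x \<bullet> x = 0" if "x \<in> sphere 0 1" for x
  proof -
    have xx: "x \<bullet> x = 1" using that norm_eq_1 by auto
    show ?thesis unfolding v_def inner_scaleR_left inner_diff_left xx inner_commute[of b x] by simp
  qed
  show "sphere_C1 (\<lambda>x. \<zeta> (x \<bullet> b)) (\<lambda>x h. v x \<bullet> h)"
    unfolding sphere_C1_def
  proof (intro conjI ballI allI)
    fix x :: 'a assume "x \<in> sphere 0 1"
    then have x: "norm x = 1" by simp
    have "\<zeta>1 (x \<bullet> b) * (h \<bullet> b) - (h \<bullet> x) *\<^sub>R (\<zeta>1 (x \<bullet> b) * (x \<bullet> b)) = v x \<bullet> h" for h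
      unfolding v_def inner_scaleR_left inner_diff_left inner_commute[of b h] inner_commute[of x h]
      by (simp add: algebra_simps)
    with has_derivative_sphere_tangential[OF chain[OF \<zeta>(1)] x]
    show "((\<lambda>x. \<zeta> (x \<bullet> b)) has_derivative (\<lambda>h. v x \<bullet> h)) (at x within sphere 0 1)" by simp
  qed (intro continuous_intros v_cont)
  show "sphere_C1 v D"
    unfolding sphere_C1_def
  proof (intro conjI ballI allI)
    fix x :: 'a
    have "((\<lambda>x. b - (x \<bullet> b) *\<^sub>R x) has_derivative (\<lambda>h. 0 - ((x \<bullet> b) *\<^sub>R h + (h \<bullet> b) *\<^sub>R x))) (at x within sphere 0 1)"
      by (intro has_derivative_diff has_derivative_const has_derivative_scaleR inner_b has_derivative_ident)
    from has_derivative_scaleR[OF chain[OF \<zeta>(2)] this]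
    have "(v has_derivative (\<lambda>h. \<zeta>1 (x \<bullet> b) *\<^sub>R (0 - ((x \<bullet> b) *\<^sub>R h + (h \<bullet> b) *\<^sub>R x))
        + (\<zeta>2 (x \<bullet> b) * (h \<bullet> b)) *\<^sub>R (b - (x \<bullet> b) *\<^sub>R x))) (at x within sphere 0 1)"
      unfolding v_def .
    then show "(v has_derivative D x) (at x within sphere 0 1)"
      unfolding D_def by (simp add: algebra_simps)
  next
    show "continuous_on (sphere 0 1) (\<lambda>x. D x h)" for h
      unfolding D_def by (intro continuous_intros comp c1 cont)
  qed
  fix x :: 'a assume "x \<in> sphere 0 1"
  then have xx: "x \<bullet> x = 1" using norm_eq_1 by auto
  define t where "t = x \<bullet> b"
  have bx: "b \<bullet> x = t" by (simp add: t_def inner_commute)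
  have bb: "b \<bullet> b = 1" using b by (rule inner_same_Basis)
  have 1: "(\<Sum>h\<in>Basis. (h \<bullet> b) * (w \<bullet> h)) = w \<bullet> b" for w
    by (subst euclidean_inner[of w b]) (simp add: inner_commute mult.commute)
  have "(\<Sum>h\<in>Basis. D x h \<bullet> h) = (\<Sum>h\<in>Basis. \<zeta>2 t * ((h \<bullet> b) * ((b - t *\<^sub>R x) \<bullet> h))
      - \<zeta>1 t * ((h \<bullet> b) * (x \<bullet> h)) - \<zeta>1 t * t)"
    unfolding D_def t_def[symmetric]
    by (intro sum.cong refl) (simp add: inner_diff_left inner_add_left algebra_simps inner_same_Basis)
  also have "\<dots> = \<zeta>2 t * ((b - t *\<^sub>R x) \<bullet> b) - \<zeta>1 t * t - real DIM('a) * (\<zeta>1 t * t)"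
    unfolding sum_subtractf sum_distrib_left[symmetric] 1 by (simp add: t_def)
  also have "(b - t *\<^sub>R x) \<bullet> b = 1 - t * t"
    unfolding inner_diff_left bb by (simp add: t_def)
  finally have "(\<Sum>h\<in>Basis. D x h \<bullet> h) = \<zeta>2 t * (1 - t * t) - \<zeta>1 t * t - real DIM('a) * (\<zeta>1 t * t)" .
  moreover have "D x x \<bullet> x = - 2 * (\<zeta>1 t * t)"
    unfolding D_def t_def[symmetric] inner_diff_left inner_add_left inner_scaleR_left xx bx by simp
  ultimately show "tangential_trace x (D x)
      = (1 - (x \<bullet> b)\<^sup>2) * \<zeta>2 (x \<bullet> b) - (real DIM('a) - 1) * (x \<bullet> b) * \<zeta>1 (x \<bullet> b)"
    unfolding tangential_trace_def t_def[symmetric] power2_eq_square by (simp add: algebra_simps)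
qed

definition zonal :: "'a::euclidean_space \<Rightarrow> nat \<Rightarrow> 'a \<Rightarrow> real" where
  "zonal b m x = poly (zonal_poly (DIM('a) - 1) m) (1 - (x \<bullet> b)\<^sup>2)"

lemma zonal_eigenfunction:
  fixes b :: "'a::euclidean_space"
  assumes b: "b \<in> Basis" and dim: "DIM('a) \<ge> 2"
  obtains v D where "sphere_C1 (zonal b m) (\<lambda>x h. v x \<bullet> h)" "sphere_C1 v D"
    "\<And>x. x \<in> sphere 0 1 \<Longrightarrow> v x \<bullet> x = 0"
    "\<And>x. x \<in> sphere 0 1 \<Longrightarrow> tangential_trace x (D x) = - (zonal_freq (DIM('a) - 1) m)\<^sup>2 * zonal b m x"
proof -
  define H where "H = zonal_poly (DIM('a) - 1) m"
  define \<zeta> where "\<zeta> t = poly H (1 - t\<^sup>2)" for t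
  define \<zeta>1 where "\<zeta>1 t = - 2 * t * poly (pderiv H) (1 - t\<^sup>2)" for t
  define \<zeta>2 where "\<zeta>2 t = - 2 * poly (pderiv H) (1 - t\<^sup>2) + 4 * t\<^sup>2 * poly (pderiv (pderiv H)) (1 - t\<^sup>2)" for t
  have P: "((\<lambda>t. poly p (1 - t\<^sup>2)) has_real_derivative - 2 * t * poly (pderiv p) (1 - t\<^sup>2)) (at t)" for p t
    by (auto intro!: derivative_eq_intros DERIV_chain2[OF poly_DERIV])
  have d1: "(\<zeta> has_real_derivative \<zeta>1 t) (at t)" for t
    unfolding \<zeta>_def \<zeta>1_def by (rule P)
  have d2: "(\<zeta>1 has_real_derivative \<zeta>2 t) (at t)" for t
    unfolding \<zeta>1_def \<zeta>2_def by (auto intro!: derivative_eq_intros P simp: power2_eq_square)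
  have c: "continuous_on UNIV \<zeta>2"
    unfolding \<zeta>2_def by (intro continuous_intros)
  have ode: "(1 - t\<^sup>2) * \<zeta>2 t - (real DIM('a) - 1) * t * \<zeta>1 t = - (zonal_freq (DIM('a) - 1) m)\<^sup>2 * \<zeta> t" for t
    using poly_zonal_ode[of "DIM('a) - 1" "1 - t\<^sup>2" m] dim
    by (simp add: \<zeta>_def \<zeta>1_def \<zeta>2_def H_def of_nat_diff) (simp add: algebra_simps power2_eq_square)
  have zonal_eq: "zonal b m = (\<lambda>x. \<zeta> (x \<bullet> b))" by (simp add: zonal_def \<zeta>_def H_def fun_eq_iff)
  note C1 = zonal_sphere_C1[OF b d1 d2 c]
  show thesis
    by (rule that[unfolded zonal_eq, OF C1(1-3)]) (simp_all add: C1(4) ode)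
qed

section \<open>Size of the zonal functions\<close>

lemma zonal_eq_perp:
  fixes b :: "'a::euclidean_space"
  assumes "b \<in> Basis" "x \<in> sphere 0 1"
  shows "zonal b m x = poly (zonal_poly (DIM('a) - 1) m) ((perp b x)\<^sup>2)"
  using perp_sq[of b x] assms by (simp add: zonal_def)

lemma dyadic_scale:
  fixes s :: real
  assumes "s \<le> 1"
  shows "s \<le> (1/2) ^ L \<or> (\<exists>k<L. (1/2) ^ Suc k < s \<and> s \<le> (1/2) ^ k)"
proof (induction L)
  case (Suc L)
  then show ?case by (meson less_Suc_eq not_le)
qed (use assms in simp)

text \<open>\<open>decay\<close> is used on dyadic shells around the axis, each enlarged to a full
  cap so that only measures of caps are needed. In the innermost cap the bound by 1 is enough, since
  \<open>2 ^ L\<close> exceeds the frequency.\<close>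

lemma zonal_sq_le:
  fixes b :: "'a::euclidean_space"
  assumes b: "b \<in> Basis" and d: "DIM('a) = d + 1" "d \<ge> 1" and m: "m \<ge> 1"
    and L: "zonal_freq d m \<le> 2 ^ L" and x: "x \<in> sphere 0 1"
  shows "(zonal b m x)\<^sup>2 \<le> (\<Sum>k\<le>L. 5 * (6 * real d / zonal_freq d m) ^ (d - 1) * (2 ^ Suc k) ^ (d - 1)
     * indicator {x \<in> sphere 0 1. perp b x \<le> (1/2) ^ k} x)"
proof -
  define \<mu> where "\<mu> = zonal_freq d m"
  define \<delta> where "\<delta> = d - 1"
  define s where "s = perp b x"
  define A where "A k = 5 * (6 * real d / \<mu>) ^ \<delta> * (2 ^ Suc k) ^ \<delta>" for k :: nat
  interpret K: zonal_profile "d - 1" "zonal_freq d m" "\<lambda>s. poly (zonal_poly d m) (s\<^sup>2)"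
    "\<lambda>s. 2 * s * poly (pderiv (zonal_poly d m)) (s\<^sup>2)"
    "\<lambda>s. 2 * poly (pderiv (zonal_poly d m)) (s\<^sup>2) + 4 * s\<^sup>2 * poly (pderiv (pderiv (zonal_poly d m))) (s\<^sup>2)"
    by (rule zonal_profile_poly) (use d m in auto)
  have \<mu>: "\<mu> > 0" unfolding \<mu>_def by (rule K.freq_pos)
  have z: "zonal b m x = poly (zonal_poly d m) (s\<^sup>2)"
    unfolding zonal_eq_perp[OF b x] using d by (simp add: s_def)
  have s: "0 \<le> s" "s \<le> 1" using perp_le_1[OF b] x by (simp_all add: s_def)
  have z1: "(zonal b m x)\<^sup>2 \<le> 1" unfolding z by (rule K.K_sq_le_1[OF s])
  have "real \<delta> + 1 = real d" using d by (simp add: \<delta>_def)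
  then have z2: "s ^ \<delta> * (zonal b m x)\<^sup>2 \<le> 5 * (6 * real d / \<mu>) ^ \<delta>"
    using K.decay[OF s] unfolding z by (simp add: \<mu>_def \<delta>_def)
  have A_nonneg: "0 \<le> A k" for k using \<mu> by (simp add: A_def)
  have "\<exists>k\<le>L. s \<le> (1/2) ^ k \<and> (zonal b m x)\<^sup>2 \<le> A k"
    using dyadic_scale[OF s(2), of L]
  proof
    assume "s \<le> (1/2) ^ L"
    moreover have "1 \<le> A L"
    proof -
      have "1 * \<mu> \<le> (6 * real d) * 2 ^ Suc L"
        using L \<mu> d unfolding \<mu>_def by (intro mult_mono) auto
      then have "1 \<le> (6 * real d / \<mu> * 2 ^ Suc L) ^ \<delta>"
        using \<mu> by (intro one_le_power) (simp add: field_simps)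
      moreover have "A L = 5 * (6 * real d / \<mu> * 2 ^ Suc L) ^ \<delta>"
        by (simp only: A_def power_mult_distrib mult.assoc)
      ultimately show ?thesis by linarith
    qed
    ultimately show ?thesis using z1 by (intro exI[of _ L]) auto
  next
    assume "\<exists>k<L. (1/2) ^ Suc k < s \<and> s \<le> (1/2) ^ k"
    then obtain k where k: "k < L" "(1/2) ^ Suc k < s" "s \<le> (1/2) ^ k" by blast
    have "1 < s * 2 ^ Suc k" using k(2) by (simp add: power_one_over field_simps)
    then have "1 \<le> (s * 2 ^ Suc k) ^ \<delta>" by (intro one_le_power) simp
    then have "(zonal b m x)\<^sup>2 * 1 \<le> (zonal b m x)\<^sup>2 * (s * 2 ^ Suc k) ^ \<delta>"
      by (intro mult_left_mono) auto
    also have "\<dots> = s ^ \<delta> * (zonal b m x)\<^sup>2 * (2 ^ Suc k) ^ \<delta>"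
      by (simp add: power_mult_distrib)
    also have "\<dots> \<le> A k" unfolding A_def using z2 by (intro mult_right_mono) auto
    finally show ?thesis using k by (intro exI[of _ k]) auto
  qed
  then obtain k where k: "k \<le> L" "s \<le> (1/2) ^ k" "(zonal b m x)\<^sup>2 \<le> A k" by blast
  have "A k * indicator {x \<in> sphere 0 1. perp b x \<le> (1/2) ^ k} x
      \<le> (\<Sum>k\<le>L. A k * indicator {x \<in> sphere 0 1. perp b x \<le> (1/2) ^ k} x)"
    by (rule member_le_sum) (use k A_nonneg in auto)
  then show ?thesis using k x by (simp add: A_def \<mu>_def \<delta>_def s_def)
qed

text \<open>The coefficient of the cap of radius \<open>(1/2) ^ k\<close> grows like
  \<open>2 ^ (k * (d - 1))\<close> and its measure is at most of order \<open>2 ^ (- k * d)\<close>,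
  so the terms decay like \<open>(1/2) ^ k\<close>.\<close>

lemma integral_zonal_sq_le:
  fixes b :: "'a::euclidean_space"
  assumes b: "b \<in> Basis" and d: "DIM('a) = d + 1" "d \<ge> 1" and m: "m \<ge> 1"
  shows "(LINT x|sphere_measure. (zonal b m x)\<^sup>2)
    \<le> 20 * real (d + 1) * (24 * real d) ^ d / zonal_freq d m ^ (d - 1)"
proof -
  interpret finite_measure "sphere_measure :: 'a measure" by (rule finite_measure_sphere)
  define \<mu> where "\<mu> = zonal_freq d m"
  define \<delta> where "\<delta> = d - 1"
  have d\<delta>: "d = Suc \<delta>" using d by (simp add: \<delta>_def)
  have \<mu>: "\<mu> > 0" using zonal_profile_poly[OF d(2) m] by (simp add: zonal_profile_def \<mu>_def)
  \<comment> \<open>Any such \<open>L\<close> will do: the final bound is uniform in the number of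
    scales.\<close>
  obtain L where "\<mu> < 2 ^ L" using real_arch_pow[of 2 \<mu>] by auto
  then have L: "zonal_freq d m \<le> 2 ^ L" by (simp add: \<mu>_def)
  define S where "S k = {x::'a. x \<in> sphere 0 1 \<and> perp b x \<le> (1/2) ^ k}" for k
  define A where "A k = 5 * (6 * real d / \<mu>) ^ \<delta> * (2 ^ Suc k) ^ \<delta>" for k :: nat
  have A_nonneg: "0 \<le> A k" for k using \<mu> by (simp add: A_def)
  have S: "S k \<in> sets sphere_measure" for k
    using perp_le_sets[of b "(1/2) ^ k"] by (auto simp: S_def sets_restrict_space)
  have S_int: "integrable sphere_measure (indicator (S k) :: 'a \<Rightarrow> real)" for k
    using S[of k] by (rule integrable_real_indicator) (simp add: emeasure_eq_measure)
  have meas: "measure sphere_measure (S k) \<le> 2 * real (d + 1) * (2 * (1/2) ^ k) ^ d" for k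
  proof -
    have "ennreal (measure sphere_measure (S k)) \<le> ennreal (2 * real (d + 1) * (2 * (1/2) ^ k) ^ d)"
      using emeasure_cap_le[OF b, of "(1/2) ^ k"] d(1)
      by (simp add: S_def emeasure_eq_measure)
    then show ?thesis by (subst (asm) ennreal_le_iff) auto
  qed
  have "(LINT x|sphere_measure. (zonal b m x)\<^sup>2) \<le> (LINT x|sphere_measure. (\<Sum>k\<le>L. A k * indicator (S k) x))"
  proof (rule integral_mono)
    have "continuous_on (sphere 0 1) (zonal b m)"
      unfolding zonal_def by (intro continuous_intros)
    then show "integrable sphere_measure (\<lambda>x. (zonal b m x)\<^sup>2)"
      by (intro integrable_sphere continuous_intros)
    show "integrable sphere_measure (\<lambda>x. \<Sum>k\<le>L. A k * indicator (S k) x)"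
      by (intro Bochner_Integration.integrable_sum integrable_mult_right S_int)
    show "(zonal b m x)\<^sup>2 \<le> (\<Sum>k\<le>L. A k * indicator (S k) x)" if "x \<in> space sphere_measure" for x
      using zonal_sq_le[OF b d m L, of x] that by (simp add: A_def S_def \<mu>_def \<delta>_def)
  qed
  also have "\<dots> = (\<Sum>k\<le>L. A k * measure sphere_measure (S k))"
  proof -
    have "(LINT x|sphere_measure. A k * indicator (S k) x) = A k * measure sphere_measure (S k)" for k
      using sets.sets_into_space[OF S[of k]] by (simp add: Int_absorb2)
    then show ?thesis
      by (subst Bochner_Integration.integral_sum) (intro integrable_mult_right S_int, simp only:)
  qed
  also have "\<dots> \<le> (\<Sum>k\<le>L. A k * (2 * real (d + 1) * (2 * (1/2) ^ k) ^ d))"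
    using meas A_nonneg by (intro sum_mono mult_left_mono) auto
  also have "\<dots> = 20 * real (d + 1) * (6 * real d / \<mu>) ^ \<delta> * 4 ^ \<delta> * (\<Sum>k\<le>L. (1/2) ^ k)"
  proof -
    have "A k * (2 * real (d + 1) * (2 * (1/2) ^ k) ^ d)
        = 20 * real (d + 1) * (6 * real d / \<mu>) ^ \<delta> * 4 ^ \<delta> * (1/2) ^ k" for k
    proof -
      have "(2 ^ Suc k) ^ \<delta> * (2 * (1/2) ^ k) ^ d = (2 ^ Suc k * (2 * (1/2) ^ k)) ^ \<delta> * (2 * (1/2) ^ k :: real)"
        by (simp only: d\<delta> power_mult_distrib power_Suc mult_ac)
      also have "2 ^ Suc k * (2 * (1/2) ^ k) = (4 :: real)" by (simp add: power_one_over)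
      finally have eq: "(2 ^ Suc k) ^ \<delta> * (2 * (1/2) ^ k) ^ d = 4 ^ \<delta> * (2 * (1/2) ^ k :: real)" .
      have "A k * (2 * real (d + 1) * (2 * (1/2) ^ k) ^ d)
          = 10 * real (d + 1) * (6 * real d / \<mu>) ^ \<delta> * ((2 ^ Suc k) ^ \<delta> * (2 * (1/2) ^ k) ^ d)"
        unfolding A_def by (simp del: power_Suc)
      then show ?thesis unfolding eq by simp
    qed
    then show ?thesis by (simp add: sum_distrib_left)
  qed
  also have "\<dots> \<le> 20 * real (d + 1) * (6 * real d / \<mu>) ^ \<delta> * 4 ^ \<delta> * 2"
  proof (rule mult_left_mono)
    show "(\<Sum>k\<le>L. (1/2) ^ k) \<le> (2::real)"
      unfolding sum_gp0 by simp
  qed (use \<mu> in auto)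
  also have "\<dots> = 20 * real (d + 1) * ((24 * real d) ^ \<delta> * 2) / \<mu> ^ \<delta>"
  proof -
    have eq: "(24 * real d) ^ \<delta> = (6 * real d) ^ \<delta> * 4 ^ \<delta>"
      unfolding power_mult_distrib[symmetric] by simp
    show ?thesis unfolding power_divide eq by simp
  qed
  also have "\<dots> \<le> 20 * real (d + 1) * ((24 * real d) ^ \<delta> * (24 * real d)) / \<mu> ^ \<delta>"
    using \<mu> d by (intro divide_right_mono mult_left_mono) auto
  also have "(24 * real d) ^ \<delta> * (24 * real d) = (24 * real d) ^ d"
    by (simp only: d\<delta> power_Suc2)
  finally show ?thesis unfolding \<mu>_def \<delta>_def .
qed

lemma zonal_ge_half:
  fixes b :: "'a::euclidean_space"
  assumes b: "b \<in> Basis" and d: "DIM('a) = d + 1" "d \<ge> 1" and m: "m \<ge> 1"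
    and x: "x \<in> sphere 0 1" "perp b x \<le> r" and r: "2 * r\<^sup>2 \<le> 1" "4 * zonal_freq d m * r \<le> 1"
  shows "zonal b m x \<ge> 1 / 2"
proof -
  interpret K: zonal_profile "d - 1" "zonal_freq d m" "\<lambda>s. poly (zonal_poly d m) (s\<^sup>2)"
    "\<lambda>s. 2 * s * poly (pderiv (zonal_poly d m)) (s\<^sup>2)"
    "\<lambda>s. 2 * poly (pderiv (zonal_poly d m)) (s\<^sup>2) + 4 * s\<^sup>2 * poly (pderiv (pderiv (zonal_poly d m))) (s\<^sup>2)"
    by (rule zonal_profile_poly) (use d m in auto)
  have "(perp b x)\<^sup>2 \<le> r\<^sup>2" using x(2) by (intro power_mono) auto
  moreover have "4 * zonal_freq d m * perp b x \<le> 4 * zonal_freq d m * r"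
    using x(2) K.freq_pos by (intro mult_left_mono) auto
  ultimately have "poly (zonal_poly d m) ((perp b x)\<^sup>2) \<ge> 1 / 2"
    using r by (intro K.K_near_0) auto
  then show ?thesis unfolding zonal_eq_perp[OF b x(1)] using d by simp
qed

section \<open>Norms and the propagator\<close>

lemma ennpowr_ennreal: "0 \<le> x \<Longrightarrow> ennpowr (ennreal x) r = ennreal (x powr r)"
  by (simp add: ennpowr_def)

lemma ennpowr_mono:
  assumes "x \<le> y" "0 \<le> r"
  shows "ennpowr x r \<le> ennpowr y r"
proof (cases "y = \<infinity>")
  case False
  then have "y < top" by (simp add: less_top)
  moreover have "x \<noteq> \<infinity>" using assms(1) calculation by auto
  ultimately show ?thesis
    using assms by (auto simp: ennpowr_def intro!: ennreal_leI powr_mono2 enn2real_mono)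
qed (simp add: ennpowr_def)

lemma recip_top [simp]: "recip top = 0"
  by (simp add: recip_def)

lemma recip_finite:
  assumes "0 < a" "a \<noteq> \<infinity>"
  shows "recip a = 1 / enn2real a" "0 < enn2real a"
proof -
  obtain r where r: "a = ennreal r" "0 \<le> r" using assms(2) by (cases a) auto
  with assms(1) have "0 < r" by simp
  then show "recip a = 1 / enn2real a" "0 < enn2real a"
    using r divide_ennreal[of 1 r] by (simp_all add: recip_def)
qed

lemma recip_half:
  assumes "2 \<le> a"
  shows "recip (a / 2) = 2 * recip a"
proof (cases a)
  case (real r)
  with assms have r: "2 \<le> r" by (metis ennreal_le_iff ennreal_numeral numeral_le_iff order_trans zero_le_numeral)
  then have "a / 2 = ennreal (r / 2)"
    using real divide_ennreal[of r 2] by simp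
  then show ?thesis
    using r real divide_ennreal[of 1 r] divide_ennreal[of 1 "r / 2"] by (simp add: recip_def)
next
  case top
  then show ?thesis by (simp add: recip_def ennreal_top_divide)
qed

text \<open>Chebyshev's inequality, used for the norms in space and in time, with finite and
  infinite exponents alike. The lower bound is asked for almost everywhere because the propagator is
  known only up to null sets.\<close>

lemma Lnorm_ge:
  assumes a: "0 < a" and A: "A \<in> sets M" and g: "AE x in M. x \<in> A \<longrightarrow> ennreal c \<le> g x"
    and c: "0 \<le> c" and m: "0 < m" "ennreal m \<le> emeasure M A"
  shows "ennreal (c * m powr recip a) \<le> Lnorm M a g"
proof (cases "a = \<infinity>")
  case True
  \<comment> \<open>Here \<open>recip a = 0\<close>, so the factor \<open>m powr recip a\<close> is
    1 and all that counts is that \<open>A\<close> is not a null set.\<close>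
  have "ennreal c \<le> esssup M g"
  proof (rule ccontr)
    assume less: "\<not> ennreal c \<le> esssup M g"
    have "AE x in M. x \<notin> A"
      using g esssup_AE[of g M] by eventually_elim (use less in auto)
    then have "emeasure M A = 0" using A sets.sets_into_space[OF A] by (subst (asm) AE_iff_measurable[of A]) auto
    then show False using m by simp
  qed
  then show ?thesis using True m by (simp add: Lnorm_def)
next
  case False
  define r where "r = enn2real a"
  have r: "recip a = 1 / r" "0 < r" using recip_finite[OF a False] by (simp_all add: r_def)
  have "ennreal (c powr r * m) = ennreal (c powr r) * ennreal m" by (simp add: ennreal_mult')
  also have "\<dots> \<le> ennreal (c powr r) * emeasure M A" using m by (intro mult_left_mono) auto
  also have "\<dots> = (\<integral>\<^sup>+x. ennreal (c powr r) * indicator A x \<partial>M)" using A by (simp add: nn_integral_cmult_indicator)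
  also have "\<dots> \<le> (\<integral>\<^sup>+x. ennpowr (g x) r \<partial>M)"
  proof (rule nn_integral_mono_AE)
    show "AE x in M. ennreal (c powr r) * indicator A x \<le> ennpowr (g x) r"
      using g
    proof eventually_elim
      case (elim x)
      then show ?case
        using ennpowr_mono[of "ennreal c" "g x" r] r c by (auto simp: indicator_def ennpowr_ennreal)
    qed
  qed
  finally have "ennpowr (ennreal (c powr r * m)) (1 / r) \<le> ennpowr (\<integral>\<^sup>+x. ennpowr (g x) r \<partial>M) (1 / r)"
    using r by (intro ennpowr_mono) auto
  also have "ennpowr (ennreal (c powr r * m)) (1 / r) = ennreal (c * m powr recip a)"
    using c m r by (simp add: ennpowr_ennreal powr_mult powr_powr)
  finally show ?thesis using False r by (simp add: Lnorm_def r_def)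
qed

lemma seq_norm_one_le:
  assumes "finite J" "J \<noteq> {}" "0 < b"
  shows "seq_norm J b (\<lambda>_. 1) \<le> ennreal (real (card J) powr recip b)"
proof (cases "b = \<infinity>")
  case True
  have "esssup (count_space J) (\<lambda>_. 1 :: ennreal) \<le> 1" by (rule esssup_I) auto
  then show ?thesis using True assms by (simp add: seq_norm_def Lnorm_def)
next
  case False
  have "ennpowr 1 r = 1" for r
    using ennpowr_ennreal[of 1 r] by simp
  then show ?thesis
    using False assms ennpowr_ennreal[of "real (card J)" "recip b"]
    by (simp add: seq_norm_def Lnorm_def emeasure_count_space ennreal_of_nat_eq_real_of_nat)
qed

section \<open>Series in the space of square-integrable functions\<close>

lemma cmod_add_sq_le: "(cmod (a + b))\<^sup>2 \<le> 2 * (cmod a)\<^sup>2 + 2 * (cmod b)\<^sup>2"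
proof -
  have "(cmod (a + b))\<^sup>2 \<le> (cmod a + cmod b)\<^sup>2"
    by (intro power_mono norm_triangle_ineq) simp
  moreover have "0 \<le> (cmod a - cmod b)\<^sup>2" by simp
  ultimately show ?thesis unfolding power2_sum power2_diff by linarith
qed

lemma in_L2_add:
  assumes "in_L2 M f" "in_L2 M g"
  shows "in_L2 M (\<lambda>x. f x + g x)"
proof -
  have [measurable]: "f \<in> borel_measurable M" "g \<in> borel_measurable M"
    using assms by (simp_all add: in_L2_def)
  have "integrable M (\<lambda>x. (cmod (f x + g x))\<^sup>2)"
  proof (rule Bochner_Integration.integrable_bound)
    show "integrable M (\<lambda>x. 2 * (cmod (f x))\<^sup>2 + 2 * (cmod (g x))\<^sup>2)"
      using assms by (simp add: in_L2_def)
    show "AE x in M. norm ((cmod (f x + g x))\<^sup>2) \<le> norm (2 * (cmod (f x))\<^sup>2 + 2 * (cmod (g x))\<^sup>2)"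
      using cmod_add_sq_le by (intro AE_I2) auto
  qed measurable
  then show ?thesis by (simp add: in_L2_def)
qed

lemma in_L2_cmult: "in_L2 M f \<Longrightarrow> in_L2 M (\<lambda>x. c * f x)"
  by (auto simp: in_L2_def norm_mult power_mult_distrib)

lemma in_L2_sum:
  assumes "\<And>k. k \<in> A \<Longrightarrow> in_L2 M (f k)"
  shows "in_L2 M (\<lambda>x. \<Sum>k\<in>A. f k x)"
  using assms
proof (induction A rule: infinite_finite_induct)
  case (insert k A)
  then show ?case by (simp add: in_L2_add)
qed (simp_all add: in_L2_def)

lemma in_L2_diff: "in_L2 M f \<Longrightarrow> in_L2 M g \<Longrightarrow> in_L2 M (\<lambda>x. f x - g x)"
  using in_L2_add[of M f "\<lambda>x. -1 * g x"] in_L2_cmult[of M g "-1"] by simp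

text \<open>Both functions are limits of the same partial sums; \<open>cmod_add_sq_le\<close> takes
  the place of the triangle inequality for the norm.\<close>

lemma L2_series_unique:
  assumes g: "L2_series M e c g" and h: "L2_series M e c h" and e: "\<And>k. in_L2 M (e k)"
  shows "AE x in M. g x = h x"
proof -
  define S where "S n x = (\<Sum>k<n. c k * e k x)" for n x
  have S: "in_L2 M (S n)" for n
    unfolding S_def by (intro in_L2_sum in_L2_cmult e)
  have gh: "in_L2 M g" "in_L2 M h" using g h by (simp_all add: L2_series_def)
  have int: "integrable M (\<lambda>x. (cmod (f x))\<^sup>2)" if "in_L2 M f" for f
    using that by (simp add: in_L2_def)
  have "(LINT x|M. (cmod (g x - h x))\<^sup>2)
      \<le> 2 * (LINT x|M. (cmod (g x - S n x))\<^sup>2) + 2 * (LINT x|M. (cmod (h x - S n x))\<^sup>2)" for n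
  proof -
    have "(LINT x|M. (cmod (g x - h x))\<^sup>2)
        \<le> (LINT x|M. 2 * (cmod (g x - S n x))\<^sup>2 + 2 * (cmod (h x - S n x))\<^sup>2)"
    proof (rule integral_mono)
      show "(cmod (g x - h x))\<^sup>2 \<le> 2 * (cmod (g x - S n x))\<^sup>2 + 2 * (cmod (h x - S n x))\<^sup>2" for x
        using cmod_add_sq_le[of "g x - S n x" "- (h x - S n x)"] by (simp add: norm_minus_commute)
    qed (intro int Bochner_Integration.integrable_add integrable_mult_right in_L2_diff gh S)+
    also have "\<dots> = 2 * (LINT x|M. (cmod (g x - S n x))\<^sup>2) + 2 * (LINT x|M. (cmod (h x - S n x))\<^sup>2)"
      by (simp add: int in_L2_diff gh S)
    finally show ?thesis .
  qed
  moreover have "(\<lambda>n. 2 * (LINT x|M. (cmod (g x - S n x))\<^sup>2) + 2 * (LINT x|M. (cmod (h x - S n x))\<^sup>2))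
      \<longlonglongrightarrow> 2 * 0 + 2 * 0"
    using g h unfolding L2_series_def S_def by (intro tendsto_intros) auto
  ultimately have "(LINT x|M. (cmod (g x - h x))\<^sup>2) \<le> 2 * 0 + 2 * 0"
    by (intro LIMSEQ_le_const) auto
  moreover have "0 \<le> (LINT x|M. (cmod (g x - h x))\<^sup>2)" by simp
  ultimately have "(LINT x|M. (cmod (g x - h x))\<^sup>2) = 0" by linarith
  then have "AE x in M. (cmod (g x - h x))\<^sup>2 = 0"
    by (subst (asm) integral_nonneg_eq_0_iff_AE) (simp_all add: int in_L2_diff gh)
  then show ?thesis by eventually_elim simp
qed

text \<open>All nonzero coefficients carry the same phase \<open>w\<close>, so \<open>w * f\<close>
  is a sum of the series. The representative chosen by \<open>SOME\<close> agrees with it almost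
  everywhere.\<close>

lemma cmod_propagator_eigenfunction:
  assumes e: "orthonormal_basis sphere_measure e" and f: "in_L2 sphere_measure f"
    and freq: "\<And>k. fourier_coeff e f k \<noteq> 0 \<Longrightarrow> lam k = \<mu>"
  shows "AE x in sphere_measure. cmod (propagator e lam \<phi> t f x) = cmod (f x)"
proof -
  define w where "w = cis (t * \<phi> \<mu>)"
  have coeff: "cis (t * \<phi> (lam k)) * fourier_coeff e f k = w * fourier_coeff e f k" for k
    using freq[of k] by (cases "fourier_coeff e f k = 0") (auto simp: w_def)
  have "L2_series sphere_measure e (\<lambda>k. fourier_coeff e f k) f"
    using e f by (simp add: orthonormal_basis_def)
  moreover have "cmod (w * a - (\<Sum>k<n. w * c k * b k)) = cmod (a - (\<Sum>k<n. c k * b k))" for a b c and n :: nat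
  proof -
    have "w * a - (\<Sum>k<n. w * c k * b k) = w * (a - (\<Sum>k<n. c k * b k))"
      by (simp add: sum_distrib_left algebra_simps)
    then show ?thesis by (simp add: norm_mult w_def)
  qed
  ultimately have wf: "L2_series sphere_measure e (\<lambda>k. cis (t * \<phi> (lam k)) * fourier_coeff e f k) (\<lambda>x. w * f x)"
    unfolding coeff by (simp add: L2_series_def in_L2_cmult)
  then have "L2_series sphere_measure e (\<lambda>k. cis (t * \<phi> (lam k)) * fourier_coeff e f k) (propagator e lam \<phi> t f)"
    unfolding propagator_def
    using someI[of "L2_series sphere_measure e (\<lambda>k. cis (t * \<phi> (lam k)) * fourier_coeff e f k)"] by blast
  then have "AE x in sphere_measure. propagator e lam \<phi> t f x = w * f x"
    using wf by (rule L2_series_unique) (use e in \<open>simp add: orthonormal_basis_def orthonormal_system_def\<close>)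
  then show ?thesis by eventually_elim (simp add: norm_mult w_def)
qed

section \<open>Fourier coefficients of the zonal functions\<close>

lemma in_L2_sphere: "continuous_on (sphere 0 1) f \<Longrightarrow> in_L2 sphere_measure f"
  unfolding in_L2_def by (intro conjI borel_measurable_sphere integrable_sphere continuous_intros)

lemma continuous_on_zonal: "continuous_on A (zonal b m)"
  unfolding zonal_def by (intro continuous_intros)

lemma zonal_orthogonal_eigenfunction:
  fixes b :: "'a::euclidean_space"
  assumes b: "b \<in> Basis" and dim: "DIM('a) \<ge> 2"
    and u: "C2_sphere u" "\<And>x. x \<in> sphere 0 1 \<Longrightarrow> sphere_laplacian u x = \<kappa> * u x"
    and neq: "\<kappa> \<noteq> (zonal_freq (DIM('a) - 1) m)\<^sup>2"
  shows "(LINT x|sphere_measure. zonal b m x * u x) = 0"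
proof -
  obtain v D where v: "sphere_C1 u (\<lambda>x h. v x \<bullet> h)" "sphere_C1 v D" "\<And>x. x \<in> sphere 0 1 \<Longrightarrow> v x \<bullet> x = 0"
    "\<And>x. x \<in> sphere 0 1 \<Longrightarrow> tangential_trace x (D x) = - sphere_laplacian u x"
    using C2_sphereE[OF u(1)] by metis
  have v4: "tangential_trace x (D x) = - \<kappa> * u x" if "x \<in> sphere 0 1" for x
    using v(4)[OF that] u(2)[OF that] by simp
  obtain z F where z: "sphere_C1 (zonal b m) (\<lambda>x h. z x \<bullet> h)" "sphere_C1 z F" "\<And>x. x \<in> sphere 0 1 \<Longrightarrow> z x \<bullet> x = 0"
    "\<And>x. x \<in> sphere 0 1 \<Longrightarrow> tangential_trace x (F x) = - (zonal_freq (DIM('a) - 1) m)\<^sup>2 * zonal b m x"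
    using zonal_eigenfunction[OF b dim, of m] by metis
  show ?thesis
    using sphere_eigenfunctions_orthogonal[OF z v(1-3) v4 neq[symmetric]] .
qed

lemma zonal_orthogonal:
  fixes b :: "'a::euclidean_space"
  assumes b: "b \<in> Basis" and dim: "DIM('a) \<ge> 2"
    and neq: "(zonal_freq (DIM('a) - 1) i)\<^sup>2 \<noteq> (zonal_freq (DIM('a) - 1) j)\<^sup>2"
  shows "(LINT x|sphere_measure. zonal b i x * zonal b j x) = 0"
proof -
  obtain v D where v: "sphere_C1 (zonal b i) (\<lambda>x h. v x \<bullet> h)" "sphere_C1 v D" "\<And>x. x \<in> sphere 0 1 \<Longrightarrow> v x \<bullet> x = 0"
    "\<And>x. x \<in> sphere 0 1 \<Longrightarrow> tangential_trace x (D x) = - (zonal_freq (DIM('a) - 1) i)\<^sup>2 * zonal b i x"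
    using zonal_eigenfunction[OF b dim, of i] by metis
  obtain z F where z: "sphere_C1 (zonal b j) (\<lambda>x h. z x \<bullet> h)" "sphere_C1 z F" "\<And>x. x \<in> sphere 0 1 \<Longrightarrow> z x \<bullet> x = 0"
    "\<And>x. x \<in> sphere 0 1 \<Longrightarrow> tangential_trace x (F x) = - (zonal_freq (DIM('a) - 1) j)\<^sup>2 * zonal b j x"
    using zonal_eigenfunction[OF b dim, of j] by metis
  show ?thesis using sphere_eigenfunctions_orthogonal[OF v z neq] .
qed

text \<open>The basis may span each eigenspace in any way, so several coefficients can be nonzero;
  what matters is that all of them belong to one eigenvalue.\<close>

lemma fourier_coeff_zonal:
  fixes b :: "'a::euclidean_space"
  assumes e: "laplace_eigenbasis e lam" and b: "b \<in> Basis" and dim: "DIM('a) \<ge> 2"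
    and nz: "fourier_coeff e (\<lambda>x. complex_of_real (a * zonal b m x)) k \<noteq> 0"
  shows "lam k = zonal_freq (DIM('a) - 1) m"
proof (rule ccontr)
  assume neq: "lam k \<noteq> zonal_freq (DIM('a) - 1) m"
  have eig: "sqrt_laplacian_eigenfunction (e k) (lam k)" using e by (simp add: laplace_eigenbasis_def)
  then have C2: "C2_sphere (\<lambda>x. Re (e k x))" "C2_sphere (\<lambda>x. Im (e k x))" and lam: "lam k \<ge> 0"
    by (simp_all add: sqrt_laplacian_eigenfunction_def)
  have "Complex (sphere_laplacian (\<lambda>y. Re (e k y)) x) (sphere_laplacian (\<lambda>y. Im (e k y)) x)
      = complex_of_real ((lam k)\<^sup>2) * e k x" if "x \<in> sphere 0 1" for x
    using eig that unfolding sqrt_laplacian_eigenfunction_def by blast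
  then have lap: "sphere_laplacian (\<lambda>y. Re (e k y)) x = (lam k)\<^sup>2 * Re (e k x)"
      "sphere_laplacian (\<lambda>y. Im (e k y)) x = (lam k)\<^sup>2 * Im (e k x)" if "x \<in> sphere 0 1" for x
    using that by (metis Re_complex_of_real Im_complex_of_real complex.sel mult_zero_left diff_zero add_0_right
      times_complex.sel)+
  have "zonal_freq (DIM('a) - 1) m \<ge> 0" using dim by (simp add: zonal_freq_def)
  then have sq: "(lam k)\<^sup>2 \<noteq> (zonal_freq (DIM('a) - 1) m)\<^sup>2"
    using neq lam by (simp add: power2_eq_iff_nonneg)
  have orth: "(LINT x|sphere_measure. zonal b m x * Re (e k x)) = 0" "(LINT x|sphere_measure. zonal b m x * Im (e k x)) = 0"
    by (rule zonal_orthogonal_eigenfunction[OF b dim C2(1) lap(1) sq], assumption)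
      (rule zonal_orthogonal_eigenfunction[OF b dim C2(2) lap(2) sq], assumption)
  have cont: "continuous_on (sphere 0 1) (\<lambda>x. Re (e k x))" "continuous_on (sphere 0 1) (\<lambda>x. Im (e k x))"
    using C2_sphereE[OF C2(1)] C2_sphereE[OF C2(2)] sphere_C1_continuous_on by metis+
  \<comment> \<open>Green's formula was proved for real functions, so the real and imaginary parts
    of \<open>e k\<close> are treated separately.\<close>
  have "fourier_coeff e (\<lambda>x. complex_of_real (a * zonal b m x)) k
      = (LINT x|sphere_measure. complex_of_real (a * (zonal b m x * Re (e k x))) - \<i> * complex_of_real (a * (zonal b m x * Im (e k x))))"
    unfolding L2_inner_def by (intro Bochner_Integration.integral_cong refl) (simp add: complex_eq_iff)
  also have "\<dots> = complex_of_real (LINT x|sphere_measure. a * (zonal b m x * Re (e k x)))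
      - \<i> * complex_of_real (LINT x|sphere_measure. a * (zonal b m x * Im (e k x)))"
  proof (subst Bochner_Integration.integral_diff)
    show "integrable sphere_measure (\<lambda>x. complex_of_real (a * (zonal b m x * Re (e k x))))"
      "integrable sphere_measure (\<lambda>x. \<i> * complex_of_real (a * (zonal b m x * Im (e k x))))"
      by (intro integrable_sphere continuous_intros continuous_on_zonal cont)+
  qed (simp only: integral_mult_right_zero integral_complex_of_real)
  also have "\<dots> = 0" by (simp add: orth)
  finally show False using nz by simp
qed

section \<open>The lower bound for the exponent\<close>

lemma zonal_freq_sq_less:
  assumes "d \<ge> 1" "i < j"
  shows "(zonal_freq d i)\<^sup>2 < (zonal_freq d j)\<^sup>2"
  unfolding zonal_freq_sq[OF assms(1)] using assms by (intro mult_strict_mono') auto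

lemma zonal_freq_bounds:
  assumes "d \<ge> 1"
  shows "2 * real m \<le> zonal_freq d m" "zonal_freq d m \<le> 2 * real m + real d"
proof -
  have "(2 * real m)\<^sup>2 \<le> real (2 * m) * (real (2 * m) + real d - 1)"
    unfolding power2_eq_square of_nat_mult of_nat_numeral using assms by (intro mult_left_mono) auto
  then show "2 * real m \<le> zonal_freq d m" unfolding zonal_freq_def by (intro real_le_rsqrt)
  have "real (2 * m) * (real (2 * m) + real d - 1) \<le> (2 * real m + real d) * (2 * real m + real d)"
    using assms by (intro mult_mono) auto
  then show "zonal_freq d m \<le> 2 * real m + real d"
    unfolding zonal_freq_def by (intro real_le_lsqrt) (simp_all add: power2_eq_square)
qed

text \<open>Lets the number of functions tend to infinity, so that constants of any size drop out of
  the comparison.\<close>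

lemma powr_growth_exponent_le:
  fixes a b c B :: real
  assumes c: "c > 0" and bound: "\<And>n::nat. n \<ge> 1 \<Longrightarrow> c * real n powr a \<le> B * real n powr b"
  shows "a \<le> b"
proof (rule ccontr)
  assume "\<not> a \<le> b"
  then have s: "a - b > 0" by simp
  \<comment> \<open>Chosen so that \<open>c * y\<close> exceeds \<open>B\<close>; the summand 1 also
    ensures \<open>n \<ge> 1\<close>.\<close>
  define y where "y = \<bar>B\<bar> / c + 1"
  have y: "y \<ge> 1" using c by (simp add: y_def)
  define n where "n = nat \<lceil>y powr (1 / (a - b))\<rceil>"
  have n: "y powr (1 / (a - b)) \<le> real n" by (simp add: n_def real_nat_ceiling_ge)
  have "1 \<le> y powr (1 / (a - b))" using y s by (intro ge_one_powr_ge_zero) auto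
  then have n1: "n \<ge> 1" using n by linarith
  have "y = (y powr (1 / (a - b))) powr (a - b)" using s y by (simp add: powr_powr)
  also have "\<dots> \<le> real n powr (a - b)" using n s by (intro powr_mono2) auto
  finally have "y * real n powr b \<le> real n powr (a - b) * real n powr b" by (intro mult_right_mono) auto
  also have "\<dots> = real n powr a" by (simp flip: powr_add)
  finally have "c * (y * real n powr b) \<le> B * real n powr b"
    using bound[OF n1] mult_left_mono[of "y * real n powr b" "real n powr a" c] c by linarith
  then have "c * y \<le> B" using n1 by (simp add: mult.assoc[symmetric])
  then show False using c by (simp add: y_def algebra_simps)
qed

theorem mainTheorem17:
  fixes d :: nat
    and e :: "nat \<Rightarrow> 'a::euclidean_space \<Rightarrow> complex" and lam :: "nat \<Rightarrow> real"
    and \<phi> :: "real \<Rightarrow> real"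
    and p q \<beta> :: ennreal and \<sigma> :: real and I :: "real set"
  assumes "d \<ge> 1" and "DIM('a) = d + 1"
    and "laplace_eigenbasis e lam"
    and "(\<exists>\<alpha>. \<alpha> > 0 \<and> \<alpha> \<noteq> 1 \<and> \<phi> = (\<lambda>s. s powr \<alpha>)) \<or>
         (\<exists>m. m \<ge> 0 \<and> \<phi> = (\<lambda>s. sqrt (m\<^sup>2 + s\<^sup>2)))"
    and "p \<ge> 2" and "q \<ge> 2" and "\<beta> > 0"
    and "is_interval I" and "bounded I" and "measure lborel I > 0"
    and "\<exists>C::real. \<forall>N::real. N \<ge> 10 \<longrightarrow>
           (\<forall>(J::nat set) f \<nu>.
              orthonormal_system sphere_measure J f \<longrightarrow>
              (\<forall>j\<in>J. \<forall>k. fourier_coeff e (f j) k \<noteq> 0 \<longrightarrow> lam k \<le> N) \<longrightarrow>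
              seq_norm J \<beta> \<nu> < \<infinity> \<longrightarrow>
              mixed_norm I sphere_measure (p / 2) (q / 2)
                  (\<lambda>t x. \<Sum>\<^sub>\<infinity>j\<in>J. \<nu> j * complex_of_real ((cmod (propagator e lam \<phi> t (f j) x))\<^sup>2))
                \<le> ennreal (C * measure lborel I powr (2 * recip p) * N powr \<sigma>) * seq_norm J \<beta> \<nu>)"
  shows "recip \<beta> \<ge> real d - 2 * real d * recip q - \<sigma>
    \<and> (recip p = real d / 2 * (1 / 2 - recip q) \<longrightarrow>
         (recip \<beta> \<ge> real d - 2 * real d * recip q - \<sigma> \<longleftrightarrow> recip \<beta> \<ge> 4 * recip p - \<sigma>))"
proof -
  note d = assms(1) and dim = assms(2) and e = assms(3) and pI = assms(10)
  obtain C :: real where C: "\<And>(N::real) (J::nat set) f \<nu>. N \<ge> 10 \<Longrightarrow>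
      orthonormal_system sphere_measure J f \<Longrightarrow>
      (\<forall>j\<in>J. \<forall>k. fourier_coeff e (f j) k \<noteq> 0 \<longrightarrow> lam k \<le> N) \<Longrightarrow> seq_norm J \<beta> \<nu> < \<infinity> \<Longrightarrow>
      mixed_norm I sphere_measure (p / 2) (q / 2)
        (\<lambda>t x. \<Sum>\<^sub>\<infinity>j\<in>J. \<nu> j * complex_of_real ((cmod (propagator e lam \<phi> t (f j) x))\<^sup>2))
        \<le> ennreal (C * measure lborel I powr (2 * recip p) * N powr \<sigma>) * seq_norm J \<beta> \<nu>"
    using assms(11) by (elim exE) (rule that, blast)
  obtain b :: 'a where b: "b \<in> Basis" using nonempty_Basis by blast
  have dim2: "DIM('a) \<ge> 2" and dim1: "DIM('a) - 1 = d" using d dim by auto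
  interpret finite_measure "sphere_measure :: 'a measure" by (rule finite_measure_sphere)
  define L where "L = measure lborel I"
  define Q where "Q m = (LINT x|sphere_measure. (zonal b m x)\<^sup>2)" for m
  define f where "f m x = complex_of_real (1 / sqrt (Q m) * zonal b m x)" for m and x :: 'a
  define C0 where "C0 = 20 * real (d + 1) * (24 * real d) ^ d"
  have C0: "C0 > 0" using d by (simp add: C0_def)
  have freq_pos: "zonal_freq d m > 0" if "m \<ge> 1" for m
    using zonal_freq_bounds(1)[OF d, of m] that by linarith
  have Q_le: "Q m \<le> C0 / zonal_freq d m ^ (d - 1)" if "m \<ge> 1" for m
    unfolding Q_def C0_def by (rule integral_zonal_sq_le[OF b dim d that])
  have Q_pos: "Q m > 0" if m: "m \<ge> 1" for m
  proof -
    \<comment> \<open>Small enough for both conditions of \<open>zonal_ge_half\<close>, the summand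
      2 giving \<open>r \<le> 1 / 2\<close>.\<close>
    define r where "r = 1 / (4 * zonal_freq d m + 2)"
    define S where "S = {x::'a. x \<in> sphere 0 1 \<and> perp b x \<le> r}"
    have r: "0 < r" "r \<le> 1 / 2" "4 * zonal_freq d m * r \<le> 1"
      using freq_pos[OF m] by (simp_all add: r_def divide_simps)
    have "r\<^sup>2 \<le> (1/2)\<^sup>2" using r by (intro power_mono) auto
    then have r2: "2 * r\<^sup>2 \<le> 1" by (simp add: power2_eq_square)
    have S: "S \<in> sets sphere_measure"
      using perp_le_sets[of b r] by (auto simp: S_def sets_restrict_space)
    have "0 < ennreal (1 / 4 * (r / (2 * real DIM('a))) ^ (DIM('a) - 1))" using r by simp
    also have "\<dots> \<le> emeasure sphere_measure S"
      unfolding S_def using r by (intro emeasure_cap_ge b) auto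
    finally have "0 < measure sphere_measure S" by (simp add: emeasure_eq_measure)
    then have "0 < 1/4 * measure sphere_measure S" by simp
    also have "\<dots> = (LINT x|sphere_measure. 1/4 * indicator S x)"
      using sets.sets_into_space[OF S] by (simp add: Int_absorb2)
    also have "\<dots> \<le> Q m"
      unfolding Q_def
    proof (rule integral_mono)
      show "integrable sphere_measure (\<lambda>x. 1/4 * indicator S x :: real)"
        using S by (intro integrable_mult_right integrable_real_indicator) (simp_all add: emeasure_eq_measure)
      show "integrable sphere_measure (\<lambda>x. (zonal b m x)\<^sup>2)"
        by (intro integrable_sphere continuous_intros continuous_on_zonal)
      fix x :: 'a
      show "1/4 * indicator S x \<le> (zonal b m x)\<^sup>2"
      proof (cases "x \<in> S")
        case True
        then have "zonal b m x \<ge> 1 / 2"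
          using r(3) r2 by (intro zonal_ge_half[OF b dim d m, of x r]) (auto simp: S_def)
        then have "(1/2)\<^sup>2 \<le> (zonal b m x)\<^sup>2" by (intro power_mono) auto
        then show ?thesis using True by (simp add: power2_eq_square)
      qed simp
    qed
    finally show ?thesis .
  qed
  have f_L2: "in_L2 sphere_measure (f m)" for m
    unfolding f_def by (intro in_L2_sphere continuous_intros continuous_on_zonal)
  have f_inner: "L2_inner sphere_measure (f i) (f j) = (if i = j then 1 else 0)" if "i \<ge> 1" "j \<ge> 1" for i j
  proof -
    have "L2_inner sphere_measure (f i) (f j)
        = (LINT x|sphere_measure. complex_of_real (1 / (sqrt (Q i) * sqrt (Q j)) * (zonal b i x * zonal b j x)))"
      unfolding L2_inner_def f_def by (intro Bochner_Integration.integral_cong refl) simp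
    also have "\<dots> = complex_of_real (1 / (sqrt (Q i) * sqrt (Q j)) * (LINT x|sphere_measure. zonal b i x * zonal b j x))"
      by (simp only: integral_mult_right_zero integral_complex_of_real)
    also have "(LINT x|sphere_measure. zonal b i x * zonal b j x) = (if i = j then Q i else 0)"
    proof (cases "i = j")
      case False
      then have "(zonal_freq (DIM('a) - 1) i)\<^sup>2 \<noteq> (zonal_freq (DIM('a) - 1) j)\<^sup>2"
        using zonal_freq_sq_less[OF d, of i j] zonal_freq_sq_less[OF d, of j i] dim1 by (auto simp: neq_iff)
      then show ?thesis using False zonal_orthogonal[OF b dim2] by simp
    qed (simp add: Q_def power2_eq_square)
    also have "1 / (sqrt (Q i) * sqrt (Q j)) * (if i = j then Q i else 0) = (if i = j then 1 else 0)"
      using Q_pos[OF that(1)] by auto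
    finally show ?thesis by simp
  qed
  have f_freq: "lam k = zonal_freq d m" if "fourier_coeff e (f m) k \<noteq> 0" for m k
    using fourier_coeff_zonal[OF e b dim2] that dim1 unfolding f_def by metis
  have cmod_prop: "AE x in sphere_measure. cmod (propagator e lam \<phi> t (f m) x) = cmod (f m x)" for t m
    using e f_L2 f_freq by (intro cmod_propagator_eigenfunction) (auto simp: laplace_eigenbasis_def)
  \<comment> \<open>The 1/4 is the square of the lower bound 1/2 for the zonal functions, and
    \<open>C0\<close> comes from \<open>Q_le\<close>. The constant \<open>c2\<close> is the bound of
    \<open>emeasure_cap_ge\<close> for the radius \<open>1 / (4 * (4 + d) * M)\<close> with the
    power of \<open>M\<close> split off.\<close>
  define c1 where "c1 = 1 / (4 * C0)"
  define c2 where "c2 = 1/4 * (1 / (8 * (real d + 1) * (4 + real d))) ^ d"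
  have c: "c1 > 0" "c2 > 0" using C0 by (simp_all add: c1_def c2_def)
  have main: "c1 * c2 powr (2 * recip q) * real M powr (real d - 2 * real d * recip q)
      \<le> \<bar>C\<bar> * (14 + real d) powr \<bar>\<sigma>\<bar> * real M powr (\<sigma> + recip \<beta>)" if M: "M \<ge> 1" for M :: nat
  proof -
    \<comment> \<open>The lower end keeps all frequencies above \<open>M\<close>, as
      \<open>f_ge\<close> needs; the upper end lets one cap serve all indices.\<close>
    define J where "J = {M..<2 * M}"
    have J: "finite J" "J \<noteq> {}" "card J = M" "\<And>j. j \<in> J \<Longrightarrow> j \<ge> 1" using M by (auto simp: J_def)
    \<comment> \<open>At least 10 as the hypothesis asks, at least \<open>2 * j + d\<close> for
      every \<open>j\<close> in \<open>J\<close>, and still of order \<open>M\<close>.\<close>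
    define N where "N = 4 * real M + real d + 10"
    have freq_le: "zonal_freq d j \<le> (4 + real d) * real M" "zonal_freq d j \<le> N"
      and freq_ge: "real M \<le> zonal_freq d j" if "j \<in> J" for j
    proof -
      have j: "M \<le> j" "j \<le> 2 * M" using that by (auto simp: J_def)
      have "real d * 1 \<le> real d * real M" using M by (intro mult_left_mono) auto
      then show "zonal_freq d j \<le> (4 + real d) * real M" "zonal_freq d j \<le> N" "real M \<le> zonal_freq d j"
        using zonal_freq_bounds[OF d, of j] j by (auto simp: N_def algebra_simps)
    qed
    define r where "r = 1 / (4 * (4 + real d) * real M)"
    define S where "S = {x::'a. x \<in> sphere 0 1 \<and> perp b x \<le> r}"
    have r0: "0 < r" using M by (simp add: r_def)
    have "1 * 1 \<le> (4 + real d) * real M" using M by (intro mult_mono) auto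
    then have r1: "r \<le> 1 / 2" unfolding r_def mult.assoc by (intro frac_le) linarith+
    have "r\<^sup>2 \<le> (1/2)\<^sup>2" using r0 r1 by (intro power_mono) auto
    then have r2: "2 * r\<^sup>2 \<le> 1" by (simp add: power2_eq_square)
    have r3: "4 * zonal_freq d j * r \<le> 1" if "j \<in> J" for j
    proof -
      have "4 * zonal_freq d j * r = zonal_freq d j / ((4 + real d) * real M)"
        unfolding r_def mult.assoc by simp
      also have "\<dots> \<le> 1" using freq_le(1)[OF that] M by simp
      finally show ?thesis .
    qed
    have S: "S \<in> sets sphere_measure"
      using perp_le_sets[of b r] by (auto simp: S_def sets_restrict_space)
    have S_ge: "ennreal (c2 / real M ^ d) \<le> emeasure sphere_measure S"
    proof -
      have eq: "c2 / real M ^ d = 1 / 4 * (r / (2 * real DIM('a))) ^ (DIM('a) - 1)"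
      proof -
        have "r / (2 * real DIM('a)) = 1 / (8 * (real d + 1) * (4 + real d)) / real M"
          unfolding r_def dim using M by (simp add: divide_simps) (simp add: algebra_simps)
        then show ?thesis
          unfolding c2_def dim1 by (simp only: power_divide[of _ "real M"] times_divide_eq_right)
      qed
      show ?thesis
        unfolding eq S_def using r0 r1 by (intro emeasure_cap_ge b) auto
    qed
    have f_ge: "real M ^ (d - 1) * c1 \<le> (cmod (f j x))\<^sup>2" if j: "j \<in> J" and x: "x \<in> S" for j x
    proof -
      have "zonal b j x \<ge> 1 / 2"
        using x r2 r3[OF j] by (intro zonal_ge_half[OF b dim d J(4)[OF j], of x r]) (auto simp: S_def)
      then have z: "(1/2)\<^sup>2 \<le> (zonal b j x)\<^sup>2" by (intro power_mono) auto
      have "real M ^ (d - 1) * c1 \<le> zonal_freq d j ^ (d - 1) * c1"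
        using freq_ge[OF j] c by (intro mult_right_mono power_mono) auto
      also have "\<dots> = (1/2)\<^sup>2 / (C0 / zonal_freq d j ^ (d - 1))"
        by (simp add: c1_def power2_eq_square)
      also have "\<dots> \<le> (zonal b j x)\<^sup>2 / Q j"
        using z Q_le[OF J(4)[OF j]] Q_pos[OF J(4)[OF j]] by (intro frac_le) auto
      also have "\<dots> = (cmod (f j x))\<^sup>2"
        using Q_pos[OF J(4)[OF j]] by (simp add: f_def norm_mult norm_divide power_mult_distrib power_divide)
      finally show ?thesis .
    qed
    \<comment> \<open>The instance \<open>\<nu> = 1\<close> of the sum in the hypothesis; the factor
      1 is kept so that the two match.\<close>
    define F where "F t x = (\<Sum>\<^sub>\<infinity>j\<in>J. (1::complex) * complex_of_real ((cmod (propagator e lam \<phi> t (f j) x))\<^sup>2))" for t x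
    have F_ge: "AE x in sphere_measure. x \<in> S \<longrightarrow> ennreal (c1 * real M ^ d) \<le> ennreal (cmod (F t x))" for t
    proof -
      have "AE x in sphere_measure. \<forall>j\<in>J. cmod (propagator e lam \<phi> t (f j) x) = cmod (f j x)"
        using J(1) cmod_prop by (intro AE_finite_allI) auto
      then show ?thesis
      proof eventually_elim
        case (elim x)
        have "F t x = complex_of_real (\<Sum>j\<in>J. (cmod (f j x))\<^sup>2)"
          using elim J(1) by (simp add: F_def)
        then have "cmod (F t x) = (\<Sum>j\<in>J. (cmod (f j x))\<^sup>2)"
          by (simp only: norm_of_real) (simp add: sum_nonneg)
        moreover have "c1 * real M ^ d \<le> (\<Sum>j\<in>J. (cmod (f j x))\<^sup>2)" if "x \<in> S"
        proof -
          have "c1 * real M ^ d = (\<Sum>j\<in>J. real M ^ (d - 1) * c1)"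
            using d J(3) by (simp add: power_eq_if)
          also have "\<dots> \<le> (\<Sum>j\<in>J. (cmod (f j x))\<^sup>2)"
            using f_ge that by (intro sum_mono) auto
          finally show ?thesis .
        qed
        ultimately show ?case by (auto intro: ennreal_leI)
      qed
    qed
    define Y where "Y = c1 * real M ^ d * (c2 / real M ^ d) powr recip (q / 2)"
    have Y0: "0 \<le> Y" using c by (simp add: Y_def)
    have halves: "0 < p / 2" "0 < q / 2"
      using assms(5,6) by (auto simp: ennreal_zero_less_divide intro: less_le_trans[of 0 2])
    have space: "ennreal Y \<le> Lnorm sphere_measure (q / 2) (\<lambda>x. ennreal (cmod (F t x)))" for t
      unfolding Y_def by (rule Lnorm_ge[OF halves(2) S F_ge]) (use c M S_ge in auto)
    \<comment> \<open>\<open>measure\<close> is 0 by default outside the measurable sets, so a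
      positive value forces measurability.\<close>
    have I: "I \<in> sets lborel" using pI measure_notin_sets by fastforce
    have emI: "emeasure lborel I = ennreal L"
      unfolding L_def using emeasure_bounded_finite[OF assms(9)] by (intro emeasure_eq_ennreal_measure) auto
    have "ennreal (Y * L powr recip (p / 2)) \<le> mixed_norm I sphere_measure (p / 2) (q / 2) F"
      unfolding mixed_norm_def
    proof (rule Lnorm_ge[OF halves(1), where A = I])
      show "I \<in> sets (restrict_space lborel I)" using I by (auto simp: sets_restrict_space)
      show "ennreal L \<le> emeasure (restrict_space lborel I) I"
        using I emI by (simp add: emeasure_restrict_space)
    qed (use space Y0 pI in \<open>auto simp: L_def\<close>)
    also have "\<dots> \<le> ennreal (C * L powr (2 * recip p) * N powr \<sigma>) * seq_norm J \<beta> (\<lambda>_. 1)"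
      unfolding F_def L_def
    proof (rule C)
      show "10 \<le> N" by (simp add: N_def)
      show "orthonormal_system sphere_measure J f"
        using f_L2 f_inner J(4) by (simp add: orthonormal_system_def)
      show "\<forall>j\<in>J. \<forall>k. fourier_coeff e (f j) k \<noteq> 0 \<longrightarrow> lam k \<le> N"
        using f_freq freq_le(2) by metis
      show "seq_norm J \<beta> (\<lambda>_. 1) < \<infinity>"
        using seq_norm_one_le[OF J(1,2) assms(7)] by (rule order.strict_trans1) simp
    qed
    \<comment> \<open>\<open>C\<close> may be negative, in which case \<open>ennreal\<close> cuts it
      off at 0; with the absolute value the comparison can move to the reals.\<close>
    also have "\<dots> \<le> ennreal (\<bar>C\<bar> * L powr (2 * recip p) * N powr \<sigma>) * ennreal (real M powr recip \<beta>)"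
      using seq_norm_one_le[OF J(1,2) assms(7)] J(3)
      by (intro mult_mono ennreal_leI mult_right_mono) auto
    also have "\<dots> = ennreal (\<bar>C\<bar> * L powr (2 * recip p) * N powr \<sigma> * real M powr recip \<beta>)"
      by (rule ennreal_mult'[symmetric]) simp
    finally have "Y * L powr recip (p / 2) \<le> \<bar>C\<bar> * L powr (2 * recip p) * N powr \<sigma> * real M powr recip \<beta>"
      by (subst (asm) ennreal_le_iff) auto
    \<comment> \<open>By \<open>recip_half\<close> both sides carry the same power of the length of
      \<open>I\<close>, which is positive and cancels.\<close>
    then have "L powr (2 * recip p) * Y \<le> L powr (2 * recip p) * (\<bar>C\<bar> * N powr \<sigma> * real M powr recip \<beta>)"
      unfolding recip_half[OF assms(5)] by (simp add: mult_ac)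
    then have Y_le: "Y \<le> \<bar>C\<bar> * N powr \<sigma> * real M powr recip \<beta>"
      using pI by (simp add: L_def)
    have "real M powr real d = real M ^ d" using M by (simp add: powr_realpow)
    then have "Y = c1 * real M powr real d * (c2 / real M powr real d) powr (2 * recip q)"
      by (simp add: Y_def recip_half[OF assms(6)])
    also have "\<dots> = c1 * c2 powr (2 * recip q) * (real M powr real d / real M powr (real d * (2 * recip q)))"
      using c by (simp add: powr_divide powr_powr)
    also have "\<dots> = c1 * c2 powr (2 * recip q) * real M powr (real d - 2 * real d * recip q)"
      by (simp add: powr_diff[symmetric] mult_ac)
    finally have Y_eq: "Y = c1 * c2 powr (2 * recip q) * real M powr (real d - 2 * real d * recip q)" .
    \<comment> \<open>The sign of \<open>\<sigma>\<close> is free, so \<open>N / M\<close> is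
      confined between 1 and \<open>14 + d\<close> and the constant is raised to
      \<open>\<bar>\<sigma>\<bar>\<close>.\<close>
    have N_le: "N powr \<sigma> \<le> (14 + real d) powr \<bar>\<sigma>\<bar> * real M powr \<sigma>"
    proof -
      have "real d * 1 \<le> real d * real M" using M by (intro mult_left_mono) auto
      then have N1: "1 \<le> N / real M" "N / real M \<le> 14 + real d"
        using M by (auto simp: N_def field_simps)
      have "(N / real M) powr \<sigma> \<le> (N / real M) powr \<bar>\<sigma>\<bar>" using N1 by (intro powr_mono) auto
      also have "\<dots> \<le> (14 + real d) powr \<bar>\<sigma>\<bar>" using N1 by (intro powr_mono2) auto
      finally have "(N / real M) powr \<sigma> * real M powr \<sigma> \<le> (14 + real d) powr \<bar>\<sigma>\<bar> * real M powr \<sigma>"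
        by (intro mult_right_mono) auto
      moreover have "(N / real M) powr \<sigma> * real M powr \<sigma> = N powr \<sigma>"
        using M by (simp add: N_def powr_mult[symmetric])
      ultimately show ?thesis by simp
    qed
    have "\<bar>C\<bar> * N powr \<sigma> * real M powr recip \<beta>
        \<le> \<bar>C\<bar> * ((14 + real d) powr \<bar>\<sigma>\<bar> * real M powr \<sigma>) * real M powr recip \<beta>"
      using N_le by (intro mult_right_mono mult_left_mono) auto
    then show ?thesis using Y_le Y_eq by (simp add: powr_add mult_ac)
  qed
  have "real d - 2 * real d * recip q \<le> \<sigma> + recip \<beta>"
    by (rule powr_growth_exponent_le[OF _ main]) (use c in auto)
  moreover have "4 * recip p = real d - 2 * real d * recip q"
    if "recip p = real d / 2 * (1 / 2 - recip q)"
    unfolding that by (simp add: algebra_simps)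
  ultimately show ?thesis by auto
qed

end
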